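(* Let $\alpha=0.09$ and $\beta=0.63$. There exists a positive constant $C$ such that for the sequence of graphs $G(0),G(1),\dots$ produced by Chain II (from an arbitrary starting graph $G(0)\in\mathcal{G}_n$): (i) after $t=Cn$ steps, with high probability (as $n\to\infty$) the number of triangles in $G(t)$ is at least $\alpha n$ and at most $\beta n$, independently of the starting graph $G(0)$; (ii) the long run number of triangles is at least $\alpha n$ and at most $\beta n$.
   Context: $\mathcal{G}_n$ is the set of simple 3-regular graphs on vertex set $[n]$, $n\ge4$ even. A make move ${\tt make}(yxvwz)$ on $G=(V,E)$, for distinct vertices $y,x,v,w,z$ with $yx,xv,vw,wz\in E$ and $xw,yz\notin E$, replaces $E$ by $(E\setminus\{xy,wz\})\cup\{xw,yz\}$. A break move ${\tt break}(vxw,yz)$, for a triangle $vxwv$ and an edge $yz$ with $\{y,z\}\cap\{v,x,w\}=\emptyset$ and $xy,wz\notin E$, replaces $E$ by $(E\setminus\{xw,yz\})\cup\{xy,wz\}$. For a vertex $v$ let $\mathcal{Q}_v$ be the set of unordered pairs $\{vxy,vwz\}$ of 2-paths with $x,w\in N_G(v)$, $x\ne w$, $wx\notin E$, $y\in N_G(x)\setminus\{v\}$, $z\in N_G(w)\setminus\{v\}$, $y\neq z$, $yz\notin E$. Chain II: at each step, choose $v\in V$ uniformly at random and let $\Delta_v$ be the number of triangles containing $v$. With probability $\Delta_v/3$: choose uniformly at random a triangle containing $v$ together with an ordering $(x,w)$ of its other two vertices, choose an oriented edge $(y,z)$ uniformly at random among the $3n$ oriented edges of $G$, and if $\{y,z\}\cap\{v,w,x\}=\emptyset$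 and $xy,wz\notin E$ perform ${\tt break}(vxw,yz)$, otherwise do nothing. Otherwise (with probability $1-\Delta_v/3$): choose $\{vxy,vwz\}\in\mathcal{Q}_v$ uniformly at random and perform ${\tt make}(yxvwz)$. An event $\mathcal{E}$ occurs in the long run if there is a positive constant $C$ such that for all $t\ge Cn$ the number of steps among the first $t$ at which $\mathcal{E}$ does not hold is $o(t)$ almost surely; "the long run number of triangles is at least $\alpha n$ and at most $\beta n$" means the events "at least $\alpha n$ triangles" and "at most $\beta n$ triangles" occur in the long run.
   Formalization: "In the long run" is mended: for every ε>0 and all large n, with probability ≥1−ε, for all t≥Cn, failures after the first Cn steps number ≤εt; and almost surely, for all large t, failures among the first t steps number ≤εt. Read literally, it fails at t=Cn from a triangle-free start. *)

theory Defs
  imports "HOL-Probability.Probability"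
begin

section \<open>Cubic graphs\<close>

text \<open>A simple graph is given by its set of edges; an edge is a two-element set of vertices.\<close>

type_synonym graph = "nat set set"

definition neighbours :: "graph \<Rightarrow> nat \<Rightarrow> nat set" where
  "neighbours E v = {u. {u, v} \<in> E}"

definition cubic_graphs :: "nat \<Rightarrow> graph set" where
  "cubic_graphs n = {E. (\<forall>e\<in>E. e \<subseteq> {1..n} \<and> card e = 2) \<and> (\<forall>v\<in>{1..n}. card (neighbours E v) = 3)}"

definition triangles :: "graph \<Rightarrow> nat set set" where
  "triangles E = {T. card T = 3 \<and> (\<forall>a\<in>T. \<forall>b\<in>T. a \<noteq> b \<longrightarrow> {a, b} \<in> E)}"

definition triangles_at :: "graph \<Rightarrow> nat \<Rightarrow> nat set set" where
  "triangles_at E v = {T \<in> triangles E. v \<in> T}"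


section \<open>Make and break moves\<close>

definition make :: "graph \<Rightarrow> nat \<Rightarrow> nat \<Rightarrow> nat \<Rightarrow> nat \<Rightarrow> nat \<Rightarrow> graph" where
  "make E y x v w z = (E - {{x, y}, {w, z}}) \<union> {{x, w}, {y, z}}"

definition break_allowed :: "graph \<Rightarrow> nat \<Rightarrow> nat \<Rightarrow> nat \<Rightarrow> nat \<Rightarrow> nat \<Rightarrow> bool" where
  "break_allowed E v x w y z \<longleftrightarrow> {y, z} \<inter> {v, w, x} = {} \<and> {x, y} \<notin> E \<and> {w, z} \<notin> E"

definition break :: "graph \<Rightarrow> nat \<Rightarrow> nat \<Rightarrow> nat \<Rightarrow> nat \<Rightarrow> nat \<Rightarrow> graph" where
  "break E v x w y z = (E - {{x, w}, {y, z}}) \<union> {{x, y}, {w, z}}"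

text \<open>A 2-path \<open>vxy\<close> is the triple \<open>(v, x, y)\<close>, so an element of \<open>path_pairs E v\<close>, that is, of
  \<open>\<Q>\<^sub>v\<close>, is a two-element set of triples.\<close>

definition path_pairs :: "graph \<Rightarrow> nat \<Rightarrow> (nat \<times> nat \<times> nat) set set" where
  "path_pairs E v = {{(v, x, y), (v, w, z)} | x y w z.
     x \<in> neighbours E v \<and> w \<in> neighbours E v \<and> x \<noteq> w \<and> {w, x} \<notin> E \<and>
     y \<in> neighbours E x - {v} \<and> z \<in> neighbours E w - {v} \<and> y \<noteq> z \<and> {y, z} \<notin> E}"

text \<open>The make move \<open>make(yxvwz)\<close> depends only on the unordered pair \<open>{vxy, vwz}\<close>.\<close>

definition make_pair :: "graph \<Rightarrow> (nat \<times> nat \<times> nat) set \<Rightarrow> graph" where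
  "make_pair E q = (THE E'. \<exists>v x y w z. q = {(v, x, y), (v, w, z)} \<and> E' = make E y x v w z)"

lemma make_pair_eq: "make_pair E {(v, x, y), (v, w, z)} = make E y x v w z"
proof -
  have "make E y' x' v' w' z' = make E y x v w z"
    if "{(v, x, y), (v, w, z)} = {(v', x', y'), (v', w', z')}" for v' x' y' w' z'
    using that by (auto simp: doubleton_eq_iff make_def insert_commute)
  then show ?thesis
    unfolding make_pair_def by (intro the_equality) blast+
qed


section \<open>Chain II\<close>

definition ordered_triangles_at :: "graph \<Rightarrow> nat \<Rightarrow> (nat \<times> nat) set" where
  "ordered_triangles_at E v = {(x, w). {v, x, w} \<in> triangles E}"

definition oriented_edges :: "graph \<Rightarrow> (nat \<times> nat) set" where
  "oriented_edges E = {(y, z). {y, z} \<in> E}"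

definition break_step :: "graph \<Rightarrow> nat \<Rightarrow> graph pmf" where
  "break_step E v = do {
     (x, w) \<leftarrow> pmf_of_set (ordered_triangles_at E v);
     (y, z) \<leftarrow> pmf_of_set (oriented_edges E);
     return_pmf (if break_allowed E v x w y z then break E v x w y z else E)
   }"

definition make_step :: "graph \<Rightarrow> nat \<Rightarrow> graph pmf" where
  "make_step E v = map_pmf (make_pair E) (pmf_of_set (path_pairs E v))"

text \<open>On a cubic graph, the uniform distributions below are only ever used with a nonempty set:
  \<open>break_step\<close> has probability 0 if \<open>v\<close> lies in no triangle, \<open>make_step\<close> has probability 0 if \<open>v\<close>
  lies in three triangles, and \<open>path_pairs E v\<close> is nonempty if \<open>v\<close> lies in at most two.\<close>

definition chainII_step :: "nat \<Rightarrow> graph \<Rightarrow> graph pmf" where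
  "chainII_step n E = do {
     v \<leftarrow> pmf_of_set {1..n};
     b \<leftarrow> bernoulli_pmf (real (card (triangles_at E v)) / 3);
     if b then break_step E v else make_step E v
   }"

text \<open>The law, on the space of all sequences of states, of a Markov chain with transition kernel
  \<open>K\<close> started at \<open>x\<close>. It is the measure of the Ionescu-Tulcea theorem; its finite-dimensional
  distributions are computed in \<open>measure_markov_chain\<close> below.\<close>

definition markov_kernel :: "('a \<Rightarrow> 'a pmf) \<Rightarrow> 'a \<Rightarrow> nat \<Rightarrow> (nat \<Rightarrow> 'a) \<Rightarrow> 'a measure" where
  "markov_kernel K x i \<omega> = measure_pmf (case i of 0 \<Rightarrow> return_pmf x | Suc j \<Rightarrow> K (\<omega> j))"

definition markov_chain :: "('a \<Rightarrow> 'a pmf) \<Rightarrow> 'a \<Rightarrow> (nat \<Rightarrow> 'a) measure" where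
  "markov_chain K x =
     projective_family.lim UNIV (Ionescu_Tulcea.CI (markov_kernel K x) (\<lambda>_. count_space UNIV))
       (\<lambda>_. count_space UNIV)"

lemma Ionescu_Tulcea_markov_kernel: "Ionescu_Tulcea (markov_kernel K x) (\<lambda>_. count_space UNIV)"
proof (rule Ionescu_Tulcea.intro)
  fix i
  show "markov_kernel K x i \<in>
      Pi\<^sub>M {0..<i} (\<lambda>_. count_space UNIV) \<rightarrow>\<^sub>M subprob_algebra (count_space UNIV)"
  proof (cases i)
    case 0
    then show ?thesis
      by (simp add: markov_kernel_def[abs_def] measure_pmf_in_subprob_algebra)
  next
    case (Suc j)
    have "(\<lambda>\<omega>. measure_pmf (K (\<omega> j))) \<in>
        Pi\<^sub>M {0..<i} (\<lambda>_. count_space UNIV) \<rightarrow>\<^sub>M subprob_algebra (count_space UNIV)"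
      by (rule measurable_compose[where g = "\<lambda>s. measure_pmf (K s)", OF measurable_component_singleton])
         (auto simp: Suc measure_pmf_in_subprob_algebra)
    then show ?thesis
      by (simp add: markov_kernel_def[abs_def] Suc)
  qed
next
  fix i \<omega>
  show "prob_space (markov_kernel K x i \<omega>)"
    unfolding markov_kernel_def by (rule prob_space_measure_pmf)
qed

lemma sets_markov_chain [measurable_cong]:
  "sets (markov_chain K x) = sets (Pi\<^sub>M UNIV (\<lambda>_. count_space UNIV))"
proof -
  interpret Ionescu_Tulcea "markov_kernel K x" "\<lambda>_. count_space UNIV"
    by (rule Ionescu_Tulcea_markov_kernel)
  show ?thesis by (simp add: markov_chain_def)
qed

lemma space_markov_chain [simp]: "space (markov_chain K x) = UNIV"
  using sets_eq_imp_space_eq[OF sets_markov_chain[of K x]] by (simp add: space_PiM)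

lemma prob_space_markov_chain: "prob_space (markov_chain K x)"
proof -
  interpret Ionescu_Tulcea "markov_kernel K x" "\<lambda>_. count_space UNIV"
    by (rule Ionescu_Tulcea_markov_kernel)
  have "emeasure PF.lim (PF.emb UNIV {} (space (PiM {} (\<lambda>_. count_space UNIV)))) =
      emeasure (CI {}) (space (PiM {} (\<lambda>_. count_space UNIV)))"
    by (rule lim) auto
  also have "\<dots> = 1"
    using PF.prob_space_P[of "{}"] prob_space.emeasure_space_1 sets_eq_imp_space_eq[OF PF.sets_P[of "{}"]]
    by (metis finite.emptyI subset_UNIV)
  also have "PF.emb UNIV {} (space (PiM {} (\<lambda>_. count_space UNIV :: 'a measure))) = UNIV"
    by (auto simp: prod_emb_def space_PiM)
  finally show ?thesis
    by (intro prob_spaceI) (simp add: markov_chain_def[symmetric])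
qed

lemma measure_markov_chain:
  "measure (markov_chain K x) {\<omega>. \<forall>i\<le>t. \<omega> i = h i} =
     indicator {x} (h 0) * (\<Prod>i<t. pmf (K (h i)) (h (Suc i)))"
proof -
  interpret Ionescu_Tulcea "markov_kernel K x" "\<lambda>_. count_space UNIV"
    by (rule Ionescu_Tulcea_markov_kernel)
  define X where "X m = PiE {0..<m} (\<lambda>i. {h i})" for m
  have X: "X m \<in> sets (PiM {0..<m} (\<lambda>_. count_space UNIV))" for m
    unfolding X_def by (rule sets_PiM_I_finite) auto
  define k where "k m = (case m of 0 \<Rightarrow> indicator {x} (h 0) | Suc j \<Rightarrow> pmf (K (h j)) (h (Suc j)))" for m
  have C: "emeasure (C 0 m (\<lambda>_. undefined)) (X m) = ennreal (\<Prod>i<m. k i)" for m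
  proof (induction m)
    case 0
    then show ?case
      by (simp add: X_def PiM_empty)
  next
    case (Suc m)
    have eP: "emeasure (eP m \<omega>) (X (Suc m)) = ennreal (k m) * indicator (X m) \<omega>"
      if \<omega>: "\<omega> \<in> space (PiM {0..<m} (\<lambda>_. count_space UNIV))" for \<omega>
    proof -
      have ext: "\<omega> \<in> extensional {0..<m}"
        using \<omega> by (simp add: space_PiM PiE_def)
      have *: "(\<lambda>y. fun_upd \<omega> m y) -` X (Suc m) = (if \<omega> \<in> X m then {h m} else {})"
      proof -
        have "fun_upd \<omega> m y \<in> X (Suc m) \<longleftrightarrow> \<omega> \<in> X m \<and> y = h m" for y
          using ext by (auto simp: X_def PiE_iff extensional_def less_Suc_eq)
        then show ?thesis by auto
      qed
      have "emeasure (markov_kernel K x m \<omega>) {h m} = ennreal (k m)" if "\<omega> \<in> X m"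
        using that
        by (auto simp: markov_kernel_def k_def emeasure_pmf_single X_def PiE_iff indicator_def split: nat.split)
      with * show ?thesis
        by (simp add: emeasure_eP[OF \<omega> X])
    qed
    have "emeasure (C 0 (Suc m) (\<lambda>_. undefined)) (X (Suc m)) =
        (\<integral>\<^sup>+ \<omega>. emeasure (eP m \<omega>) (X (Suc m)) \<partial>C 0 m (\<lambda>_. undefined))"
      using measurable_eP[of m] by (auto intro!: emeasure_bind[OF _ _ X] simp: space_C measurable_cong_sets[OF sets_C])
    also have "\<dots> = (\<integral>\<^sup>+ \<omega>. ennreal (k m) * indicator (X m) \<omega> \<partial>C 0 m (\<lambda>_. undefined))"
      by (intro nn_integral_cong eP) (simp add: space_C)
    also have "\<dots> = ennreal (k m) * emeasure (C 0 m (\<lambda>_. undefined)) (X m)"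
      using X[of m] by (intro nn_integral_cmult_indicator) (simp add: sets_C)
    also have "\<dots> = ennreal (\<Prod>i<Suc m. k i)"
      by (simp add: Suc ennreal_mult'' prod_nonneg k_def mult.commute split: nat.split)
    finally show ?case .
  qed
  have "{\<omega>. \<forall>i\<le>t. \<omega> i = h i} = PF.emb UNIV {0..<Suc t} (X (Suc t))"
    by (auto simp: prod_emb_def X_def space_PiM PiE_iff less_Suc_eq_le)
  then have "emeasure (markov_chain K x) {\<omega>. \<forall>i\<le>t. \<omega> i = h i} = emeasure (CI {0..<Suc t}) (X (Suc t))"
    using lim[OF _ X, of "Suc t"] by (simp add: markov_chain_def)
  also have "\<dots> = emeasure (C 0 (Suc t) (\<lambda>_. undefined)) (X (Suc t))"
    using X[of "Suc t"] by (subst emeasure_CI[of _ "Suc t"]) (auto simp: prod_emb_id space_PiM X_def PiE_def)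
  also have "\<dots> = ennreal (\<Prod>i<Suc t. k i)"
    by (rule C)
  also have "(\<Prod>i<Suc t. k i) = indicator {x} (h 0) * (\<Prod>i<t. pmf (K (h i)) (h (Suc i)))"
    by (subst prod.lessThan_Suc_shift) (simp add: k_def)
  finally show ?thesis
    by (simp add: measure_def prod_nonneg)
qed

definition chainII :: "nat \<Rightarrow> graph \<Rightarrow> (nat \<Rightarrow> graph) measure" where
  "chainII n G = markov_chain (chainII_step n) G"

text \<open>\<open>\<E> n E\<close> says that the event \<open>\<E>\<close> holds for the graph \<open>E\<close> on \<open>{1..n}\<close>.

  The event occurs in the long run if the number of steps \<open>s\<close> among the first \<open>t \<ge> C n\<close> at which it
  fails is \<open>o(t)\<close> almost surely. The \<open>o(t)\<close> refers to large \<open>n\<close>: for fixed \<open>n\<close> an ergodic chain spends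
  a positive proportion of time in every state. It cannot hold for all \<open>t \<ge> C n\<close> if the initial
  period is counted: from a starting graph far from the event, the event fails during the first
  \<open>\<Omega>(n)\<close> steps, a positive proportion of the first \<open>C n\<close>. So there are two requirements, for
  every \<open>\<epsilon> > 0\<close> and all large \<open>n\<close>, whatever the starting graph: with high probability, for all
  \<open>t \<ge> C n\<close> simultaneously, at most \<open>\<epsilon> t\<close> failures after the initial \<open>C n\<close> steps; and almost
  surely, as \<open>t \<rightarrow> \<infinity>\<close>, eventually at most \<open>\<epsilon> t\<close> failures among all of the first \<open>t\<close> steps.\<close>

definition in_the_long_run :: "(nat \<Rightarrow> graph \<Rightarrow> bool) \<Rightarrow> bool" where
  "in_the_long_run \<E> \<longleftrightarrow>
     (\<exists>C::real. C > 0 \<and>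
       (\<forall>\<epsilon>>0. \<forall>\<^sub>F n in sequentially. even n \<longrightarrow>
         (\<forall>G\<in>cubic_graphs n.
           \<P>(\<omega> in chainII n G. \<forall>t::nat. C * real n \<le> real t \<longrightarrow>
              real (card {s \<in> {1..t}. C * real n \<le> real s \<and> \<not> \<E> n (\<omega> s)}) \<le> \<epsilon> * real t) \<ge> 1 - \<epsilon> \<and>
           (AE \<omega> in chainII n G. \<forall>\<^sub>F t in sequentially.
              real (card {s \<in> {1..t}. \<not> \<E> n (\<omega> s)}) \<le> \<epsilon> * real t))))"

end

theory Submission
  imports Defs
begin

text \<open>
  Let \<open>\<tau>\<close> be the number of triangles divided by \<open>n\<close>; one step changes the number of triangles by at
  most 4. A break move is chosen with probability \<open>\<tau>\<close>.

  For the lower bound, a make move at \<open>v\<close> creates a triangle and destroys at most those that meet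
  \<open>N(v)\<close>; averaging over \<open>v\<close>, the expected number lost is at most \<open>5\<tau>\<close>. Hence the drift is at least
  \<open>(1 - \<tau>) - 5\<tau> - 4\<tau> = 1 - 10\<tau>\<close>, which is bounded away from 0 for \<open>\<tau> \<le> 0.095\<close>.

  For the upper bound, a make move creates at most 4 triangles. In a break move \<open>break(vxw, yz)\<close>, with
  probability \<open>1 - O(1/n)\<close> the random edge \<open>yz\<close> is far from \<open>vxw\<close>; then the move creates no triangle and
  destroys those on \<open>xw\<close> and those on \<open>yz\<close>. By double counting, the drift is at most
  \<open>4(1 - \<tau>) - (3\<tau> - 1) - 2\<tau>\<^sup>2 + O(1/n)\<close>, which is bounded away from 0 for \<open>\<tau> \<ge> 0.62\<close>.

  If \<open>Y\<close> denotes the distance on the wrong side of 0.095 or 0.62, then \<open>W = exp (\<lambda> Y)\<close> contracts: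
  \<open>E W' \<le> (1 - \<rho>) W + 2\<close>. So \<open>E W\<close> is bounded after \<open>O(n)\<close> steps, which gives (i) since \<open>W\<close> is
  exponentially large in \<open>n\<close> at a failure. For (ii), \<open>V = 1 + \<zeta> W\<close> with an exponentially small \<open>\<zeta>\<close>
  satisfies \<open>E V' \<le> (1 + 4\<zeta>) V\<close> always and gains a further constant factor \<open>1 - \<rho>/2\<close> at each failure.
  So the probability of \<open>\<epsilon> t\<close> failures decays exponentially in \<open>t\<close>, and a union bound over \<open>t\<close>
  and the Borel-Cantelli lemma apply.
\<close>

section \<open>Finite-horizon expectations of a Markov chain\<close>

text \<open>A finite substitute for the expectation of a functional of the first
  \<open>t + 1\<close> states, over paths that stay in \<open>S\<close>. For finite \<open>S\<close>
  it raises no question of measurability or integrability.\<close>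

definition path_sum ::
    "('a \<Rightarrow> 'a pmf) \<Rightarrow> 'a set \<Rightarrow> 'a \<Rightarrow> nat \<Rightarrow> ((nat \<Rightarrow> 'a) \<Rightarrow> real) \<Rightarrow> real" where
  "path_sum K S x t F =
     (\<Sum>h\<in>PiE {..t} (\<lambda>_. S). measure (markov_chain K x) {\<omega>. \<forall>i\<le>t. \<omega> i = h i} * F h)"

lemma pred_component_count_space:
  "Measurable.pred (Pi\<^sub>M UNIV (\<lambda>_. count_space UNIV)) (\<lambda>\<omega>. P (\<omega> i))"
  by (rule measurable_compose[OF measurable_component_singleton]) simp_all

lemma sets_failure_count:
  "{\<omega>. a < real (card {i\<in>{s..t}. P (\<omega> i)})} \<in> sets (markov_chain K x)"
proof -
  note pred_component_count_space[where P = P, measurable]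
  \<comment> \<open>As a finite sum of indicators, the count is measurable because single
    coordinates are.\<close>
  have "{\<omega>. a < real (card {i\<in>{s..t}. P (\<omega> i)})} = {\<omega> \<in> space (markov_chain K x).
      a < (\<Sum>i\<in>{s..t}. if P (\<omega> i) then 1 else 0)}"
    by (simp add: sum.If_cases Int_def)
  also have "\<dots> \<in> sets (markov_chain K x)" by measurable
  finally show ?thesis .
qed

lemma path_sum_mono:
  assumes "\<And>h. h \<in> PiE {..t} (\<lambda>_. S) \<Longrightarrow> F h \<le> G h"
  shows "path_sum K S x t F \<le> path_sum K S x t G"
  unfolding path_sum_def by (intro sum_mono mult_left_mono assms) auto

lemma path_sum_cong:
  assumes "\<And>h. h \<in> PiE {..t} (\<lambda>_. S) \<Longrightarrow> F h = G h"
  shows "path_sum K S x t F = path_sum K S x t G"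
  unfolding path_sum_def by (intro sum.cong refl arg_cong2[where f = "(*)"] assms)

lemma path_sum_cmult: "path_sum K S x t (\<lambda>h. a * F h) = a * path_sum K S x t F"
  by (simp add: path_sum_def sum_distrib_left algebra_simps)

lemma path_sum_add:
  "path_sum K S x t (\<lambda>h. F h + G h) = path_sum K S x t F + path_sum K S x t G"
  by (simp add: path_sum_def sum.distrib algebra_simps)

lemma path_sum_nonneg:
  assumes "\<And>h. h \<in> PiE {..t} (\<lambda>_. S) \<Longrightarrow> 0 \<le> F h"
  shows "0 \<le> path_sum K S x t F"
  unfolding path_sum_def by (intro sum_nonneg mult_nonneg_nonneg assms) auto

lemma path_sum_0:
  assumes "finite S" "x \<in> S"
  shows "path_sum K S x 0 F = F (\<lambda>i\<in>{..0}. x)"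
proof -
  have "path_sum K S x 0 F = (\<Sum>h\<in>PiE {..0} (\<lambda>_. S). indicator {x} (h 0) * F h)"
    unfolding path_sum_def by (subst measure_markov_chain) simp
  also have "\<dots> = (\<Sum>h\<in>{\<lambda>i\<in>{..0}. x}. indicator {x} (h 0) * F h)"
  proof (rule sum.mono_neutral_right)
    show "finite (PiE {..0::nat} (\<lambda>_. S))" using assms(1) by (intro finite_PiE) simp_all
    show "{\<lambda>i\<in>{..0::nat}. x} \<subseteq> PiE {..0} (\<lambda>_. S)" using assms(2) by simp
    have "h = (\<lambda>i\<in>{..0}. x)" if "h \<in> PiE {..0::nat} (\<lambda>_. S)" "h 0 = x" for h
      by (rule PiE_ext[OF that(1)]) (use assms(2) that(2) in simp_all)
    then show "\<forall>h\<in>PiE {..0::nat} (\<lambda>_. S) - {\<lambda>i\<in>{..0}. x}. indicator {x} (h 0) * F h = 0"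
      by (metis DiffE indicator_simps(2) insertCI mult_zero_left singletonD)
  qed
  finally show ?thesis by simp
qed

text \<open>The weight of a cylinder is a product of transition probabilities, so the last factor
  splits off. This is the form of the Markov property used for induction on time.\<close>

lemma path_sum_Suc:
  "path_sum K S x (Suc t) F =
     path_sum K S x t (\<lambda>h. \<Sum>y\<in>S. pmf (K (h t)) y * F (h(Suc t := y)))"
proof -
  let ?p = "\<lambda>t h. measure (markov_chain K x) {\<omega>. \<forall>i\<le>t. \<omega> i = h i}"
  have inj: "inj_on (\<lambda>(y, g). g(Suc t := y)) (S \<times> PiE {..t} (\<lambda>_. S))"
    using inj_combinator[of "Suc t" "{..t}" "\<lambda>_. S"] by simp
  have p: "?p (Suc t) (h(Suc t := y)) = ?p t h * pmf (K (h t)) y" for h y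
    by (simp only: measure_markov_chain) simp
  have "path_sum K S x (Suc t) F =
      (\<Sum>h\<in>(\<lambda>(y, g). g(Suc t := y)) ` (S \<times> PiE {..t} (\<lambda>_. S)). ?p (Suc t) h * F h)"
    unfolding path_sum_def atMost_Suc by (subst PiE_insert_eq) simp
  also have "\<dots> = (\<Sum>(y, h)\<in>S \<times> PiE {..t} (\<lambda>_. S). ?p t h * pmf (K (h t)) y * F (h(Suc t := y)))"
    by (subst sum.reindex[OF inj], rule sum.cong) (auto simp: p simp del: fun_upd_apply)
  also have "\<dots> = (\<Sum>h\<in>PiE {..t} (\<lambda>_. S). \<Sum>y\<in>S. ?p t h * pmf (K (h t)) y * F (h(Suc t := y)))"
    by (subst sum.cartesian_product[symmetric], rule sum.swap)
  finally show ?thesis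
    by (simp add: path_sum_def sum_distrib_left mult.assoc)
qed

section \<open>Chains confined to a finite closed set\<close>

locale closed_chain =
  fixes K :: "'a \<Rightarrow> 'a pmf" and S :: "'a set"
  assumes finite_S: "finite S" and closed: "\<And>z. z \<in> S \<Longrightarrow> set_pmf (K z) \<subseteq> S"
begin

lemma sum_pmf_S: "z \<in> S \<Longrightarrow> (\<Sum>y\<in>S. pmf (K z) y * f y) = measure_pmf.expectation (K z) f"
  using closed[of z] by (subst integral_measure_pmf_real[OF finite_S]) (auto simp: mult.commute)

lemma path_sum_one: "x \<in> S \<Longrightarrow> path_sum K S x t (\<lambda>_. 1) = 1"
proof (induction t)
  case (Suc t)
  have "path_sum K S x (Suc t) (\<lambda>_. 1) = path_sum K S x t (\<lambda>_. 1)"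
    using sum_pmf_S[where f = "\<lambda>_. 1"]
    by (subst path_sum_Suc, intro path_sum_cong) (auto simp: PiE_iff)
  with Suc show ?case by simp
qed (simp add: path_sum_0 finite_S)

text \<open>The hypothesis says that \<open>F\<close> ignores coordinate \<open>Suc t\<close>, so
  only \<open>f\<close> is averaged over the last transition: conditioning on the past.\<close>

lemma path_sum_step:
  assumes "\<And>h y. F (h(Suc t := y)) = F h"
  shows "path_sum K S x (Suc t) (\<lambda>h. F h * f (h (Suc t))) =
    path_sum K S x t (\<lambda>h. F h * measure_pmf.expectation (K (h t)) f)"
proof -
  have "(\<Sum>y\<in>S. pmf (K (h t)) y * (F h * f y)) = F h * measure_pmf.expectation (K (h t)) f"
    if "h \<in> PiE {..t} (\<lambda>_. S)" for h
  proof -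
    have "h t \<in> S" using that by auto
    from sum_pmf_S[OF this, of f] show ?thesis
      by (simp flip: sum_distrib_left add: mult.left_commute)
  qed
  then show ?thesis
    by (subst path_sum_Suc, intro path_sum_cong) (simp add: assms)
qed

text \<open>The bridge from events on infinite trajectories to path sums, in the manner of Markov's
  inequality: \<open>F\<close> has to be at least 1 on every cylinder that meets \<open>A\<close>,
  and trajectories leaving \<open>S\<close> by time \<open>t\<close> have probability 0.\<close>

lemma prob_le_path_sum:
  assumes x: "x \<in> S" and A: "A \<in> sets (markov_chain K x)"
    and F: "\<And>h. h \<in> PiE {..t} (\<lambda>_. S) \<Longrightarrow> 0 \<le> F h"
    and AF: "\<And>h \<omega>. h \<in> PiE {..t} (\<lambda>_. S) \<Longrightarrow> \<omega> \<in> A \<Longrightarrow> (\<forall>i\<le>t. \<omega> i = h i) \<Longrightarrow> 1 \<le> F h"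
  shows "measure (markov_chain K x) A \<le> path_sum K S x t F"
proof -
  let ?M = "markov_chain K x"
  interpret prob_space ?M by (rule prob_space_markov_chain)
  define P where "P = PiE {..t} (\<lambda>_. S)"
  define cyl where "cyl h = {\<omega>. \<forall>i\<le>t. \<omega> i = h i}" for h :: "nat \<Rightarrow> 'a"
  have finP: "finite P" unfolding P_def using finite_S by (intro finite_PiE) auto
  have cyl[measurable]: "cyl h \<in> sets ?M" for h
  proof -
    have "{\<omega> \<in> space ?M. \<forall>i\<le>t. \<omega> i = h i} \<in> sets ?M" by measurable
    then show ?thesis by (simp add: cyl_def)
  qed
  have disj: "disjoint_family_on cyl P"
    by (auto simp: disjoint_family_on_def cyl_def P_def PiE_iff extensional_def fun_eq_iff) metis
  have "measure ?M (\<Union>h\<in>P. cyl h) = (\<Sum>h\<in>P. measure ?M (cyl h))"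
    by (rule finite_measure_finite_Union[OF finP _ disj]) auto
  also have "\<dots> = 1" using path_sum_one[OF x, of t] by (simp add: path_sum_def P_def cyl_def)
  finally have one: "measure ?M (\<Union>h\<in>P. cyl h) = 1" .
  \<comment> \<open>The trajectories that leave \<open>S\<close> by time \<open>t\<close>. They form
    a null set because the cylinders over \<open>S\<close> already have total mass 1.\<close>
  define R where "R = space ?M - (\<Union>h\<in>P. cyl h)"
  have U: "(\<Union>h\<in>P. cyl h) \<in> sets ?M" by (rule sets.finite_UN[OF finP cyl])
  have R: "measure ?M R = 0" "R \<in> sets ?M"
    unfolding R_def prob_compl[OF U] one using sets.compl_sets[OF U] by simp_all
  define H where "H = {h \<in> P. A \<inter> cyl h \<noteq> {}}"
  have finH: "finite H" using finP by (simp add: H_def)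
  have UH: "(\<Union>h\<in>H. cyl h) \<in> sets ?M" by (rule sets.finite_UN[OF finH cyl])
  have "A \<subseteq> R \<union> (\<Union>h\<in>H. cyl h)" by (auto simp: R_def H_def)
  then have "measure ?M A \<le> measure ?M (R \<union> (\<Union>h\<in>H. cyl h))"
    using R UH by (intro finite_measure_mono) simp_all
  also have "\<dots> \<le> measure ?M R + measure ?M (\<Union>h\<in>H. cyl h)"
    using R UH by (intro measure_Un_le)
  also have "\<dots> \<le> 0 + (\<Sum>h\<in>H. measure ?M (cyl h))"
    using R finH by (intro add_mono finite_measure_subadditive_finite) auto
  also have "\<dots> \<le> (\<Sum>h\<in>H. measure ?M (cyl h) * F h)"
  proof -
    have "1 \<le> F h" if "h \<in> H" for h
      using AF[of h] that by (auto simp: H_def P_def cyl_def)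
    then show ?thesis by (auto intro!: sum_mono simp: mult_le_cancel_left1)
  qed
  also have "\<dots> \<le> (\<Sum>h\<in>P. measure ?M (cyl h) * F h)"
    using finP F by (intro sum_mono2) (auto simp: H_def P_def)
  finally show ?thesis by (simp add: path_sum_def P_def cyl_def)
qed

text \<open>Unrolling the recursion gives a geometric series; \<open>B / \<rho>\<close> is the fixed
  point of the recursion.\<close>

lemma path_sum_contraction:
  assumes x: "x \<in> S" and \<rho>: "0 < \<rho>" "\<rho> \<le> 1" and B: "0 \<le> B"
    and W: "\<And>z. z \<in> S \<Longrightarrow> measure_pmf.expectation (K z) W \<le> (1 - \<rho>) * W z + B"
  shows "path_sum K S x t (\<lambda>h. W (h t)) \<le> (1 - \<rho>) ^ t * W x + B / \<rho>"
proof (induction t)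
  case 0
  then show ?case using \<rho> B by (simp add: path_sum_0 finite_S x)
next
  case (Suc t)
  have "path_sum K S x (Suc t) (\<lambda>h. W (h (Suc t))) =
      path_sum K S x t (\<lambda>h. measure_pmf.expectation (K (h t)) W)"
    using path_sum_step[where F = "\<lambda>_. 1"] by simp
  also have "\<dots> \<le> path_sum K S x t (\<lambda>h. (1 - \<rho>) * W (h t) + B * 1)"
    by (intro path_sum_mono) (auto intro!: W)
  also have "\<dots> = (1 - \<rho>) * path_sum K S x t (\<lambda>h. W (h t)) + B"
    by (simp only: path_sum_add path_sum_cmult path_sum_one[OF x])
  also have "\<dots> \<le> (1 - \<rho>) * ((1 - \<rho>) ^ t * W x + B / \<rho>) + B"
    using \<rho> Suc by (intro add_mono mult_left_mono) auto
  also have "\<dots> = (1 - \<rho>) ^ Suc t * W x + B / \<rho>"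
    using \<rho> by (simp add: field_simps)
  finally show ?case .
qed

text \<open>Up to a factor \<open>\<kappa>\<close> per step, the weighted product is a
  supermartingale. With \<open>u\<close> above 1 exactly at bad states, the product records how many
  of them were visited, so this controls an exponential moment of their number.\<close>

lemma path_sum_multiplicative:
  assumes \<kappa>: "0 \<le> \<kappa>" and u: "\<And>z. z \<in> S \<Longrightarrow> 0 \<le> u z"
    and V: "\<And>z. z \<in> S \<Longrightarrow> u z * measure_pmf.expectation (K z) V \<le> \<kappa> * V z"
    and "s \<le> t"
  shows "path_sum K S x t (\<lambda>h. (\<Prod>i\<in>{s..<t}. u (h i)) * V (h t)) \<le>
    \<kappa> ^ (t - s) * path_sum K S x s (\<lambda>h. V (h s))"
  using \<open>s \<le> t\<close>
proof (induction t rule: dec_induct)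
  case (step t)
  have "path_sum K S x (Suc t) (\<lambda>h. (\<Prod>i\<in>{s..<Suc t}. u (h i)) * V (h (Suc t))) =
      path_sum K S x t (\<lambda>h. (\<Prod>i\<in>{s..<Suc t}. u (h i)) * measure_pmf.expectation (K (h t)) V)"
    by (rule path_sum_step) (auto intro!: prod.cong)
  also have "\<dots> \<le> path_sum K S x t (\<lambda>h. \<kappa> * ((\<Prod>i\<in>{s..<t}. u (h i)) * V (h t)))"
  proof (rule path_sum_mono)
    fix h assume h: "h \<in> PiE {..t} (\<lambda>_. S)"
    have "0 \<le> (\<Prod>i\<in>{s..<t}. u (h i))" using h by (intro prod_nonneg) (auto intro!: u)
    moreover have "h t \<in> S" using h by auto
    ultimately have "(\<Prod>i\<in>{s..<t}. u (h i)) * (u (h t) * measure_pmf.expectation (K (h t)) V) \<le>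
        (\<Prod>i\<in>{s..<t}. u (h i)) * (\<kappa> * V (h t))"
      by (intro mult_left_mono V) auto
    then show "(\<Prod>i\<in>{s..<Suc t}. u (h i)) * measure_pmf.expectation (K (h t)) V \<le>
        \<kappa> * ((\<Prod>i\<in>{s..<t}. u (h i)) * V (h t))"
      using step.hyps by (simp add: prod.atLeastLessThan_Suc algebra_simps)
  qed
  also have "\<dots> \<le> \<kappa> * (\<kappa> ^ (t - s) * path_sum K S x s (\<lambda>h. V (h s)))"
    unfolding path_sum_cmult using \<kappa> step.IH by (intro mult_left_mono)
  finally show ?case using step.hyps by (simp add: Suc_diff_le)
qed simp

end


section \<open>Chains with negative drift\<close>

lemma exp_le_quadratic:
  assumes "\<bar>x\<bar> \<le> (1::real)"
  shows "exp x \<le> 1 + x + x\<^sup>2"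
proof (cases "0 \<le> x")
  case True
  then show ?thesis using assms exp_bound[of x] by simp
next
  case False
  \<comment> \<open>For negative \<open>x\<close> the claim is multiplied by
    \<open>exp (- x)\<close>, which is at least \<open>1 - x\<close>; what remains is
    \<open>1 \<le> 1 - x ^ 3\<close>.\<close>
  have "1 \<le> (1 + x + x\<^sup>2) * (1 - x)"
  proof -
    have "(1 + x + x\<^sup>2) * (1 - x) = 1 - x ^ 3"
      by (simp add: algebra_simps power2_eq_square power3_eq_cube)
    moreover have "x ^ 3 \<le> 0" using False by (simp add: power_le_zero_eq)
    ultimately show ?thesis by simp
  qed
  also have "\<dots> \<le> (1 + x + x\<^sup>2) * exp (- x)"
  proof (rule mult_left_mono)
    show "1 - x \<le> exp (- x)" using exp_ge_add_one_self[of "- x"] by simp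
    have "0 \<le> 1 + x" using assms by linarith
    then show "0 \<le> 1 + x + x\<^sup>2" by simp
  qed
  finally show ?thesis by (simp add: exp_minus field_simps)
qed

locale drift_chain = closed_chain K S
  for K :: "'a \<Rightarrow> 'a pmf" and S :: "'a set" +
  fixes Y :: "'a \<Rightarrow> real" and c :: real
  assumes c: "0 < c" "c \<le> 1"
    and jump: "\<And>z z'. z \<in> S \<Longrightarrow> z' \<in> set_pmf (K z) \<Longrightarrow> \<bar>Y z' - Y z\<bar> \<le> 4"
    and drift: "\<And>z. z \<in> S \<Longrightarrow> 0 \<le> Y z \<Longrightarrow>
      measure_pmf.expectation (K z) (\<lambda>z'. Y z' - Y z) \<le> - c"
begin

text \<open>This value minimises \<open>16 * lam\<^sup>2 - c * lam\<close>, the exponential drift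
  after second-order expansion with jumps of size 4; the minimum is \<open>- rho\<close>.\<close>

definition "lam = c / 32"
definition "rho = c\<^sup>2 / 64"

lemma lam_pos: "0 < lam" and rho_pos: "0 < rho" and rho_le: "rho \<le> 1/64"
  using c by (auto simp: lam_def rho_def power_le_one)

lemma finite_set_pmf_K: "z \<in> S \<Longrightarrow> finite (set_pmf (K z))"
  using closed finite_S finite_subset by blast

lemma integrable_K: "z \<in> S \<Longrightarrow> integrable (measure_pmf (K z)) (f :: 'a \<Rightarrow> real)"
  by (intro integrable_measure_pmf_finite finite_set_pmf_K)

text \<open>Where \<open>Y z\<close> is nonnegative, a second-order expansion plays the drift
  \<open>- c\<close> against the squared jump. Elsewhere one jump leaves \<open>Y\<close> below 4,
  and the additive constant 2 covers the exponential.\<close>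

lemma expectation_exp:
  assumes z: "z \<in> S"
  shows "measure_pmf.expectation (K z) (\<lambda>z'. exp (lam * Y z')) \<le> (1 - rho) * exp (lam * Y z) + 2"
proof -
  let ?E = "measure_pmf.expectation (K z)"
  have small: "lam * 4 \<le> 1/8" using c by (simp add: lam_def)
  show ?thesis
  proof (cases "0 \<le> Y z")
    case True
    have "?E (\<lambda>z'. exp (lam * Y z')) \<le>
        ?E (\<lambda>z'. exp (lam * Y z) * (1 + lam * (Y z' - Y z) + 16 * lam\<^sup>2))"
    proof (intro integral_mono_AE integrable_K z, unfold AE_measure_pmf_iff, rule ballI)
      fix z' assume z': "z' \<in> set_pmf (K z)"
      define d where "d = Y z' - Y z"
      have d: "\<bar>d\<bar> \<le> 4" using jump[OF z z'] by (simp add: d_def)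
      have ld: "\<bar>lam * d\<bar> \<le> lam * 4" using d lam_pos by (simp add: abs_mult)
      have "exp (lam * Y z') = exp (lam * Y z) * exp (lam * d)"
        by (simp add: d_def algebra_simps flip: exp_add)
      also have "exp (lam * d) \<le> 1 + lam * d + (lam * d)\<^sup>2"
        using ld small by (intro exp_le_quadratic) linarith
      also have "(lam * d)\<^sup>2 \<le> (lam * 4)\<^sup>2"
        using ld lam_pos by (intro power2_le_iff_abs_le[THEN iffD2]) auto
      finally show "exp (lam * Y z') \<le> exp (lam * Y z) * (1 + lam * (Y z' - Y z) + 16 * lam\<^sup>2)"
        by (simp add: d_def power_mult_distrib mult.commute)
    qed
    also have "\<dots> = exp (lam * Y z) * (1 + lam * ?E (\<lambda>z'. Y z' - Y z) + 16 * lam\<^sup>2)"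
      using integrable_K[OF z] by (simp add: integral_add)
    also have "\<dots> \<le> exp (lam * Y z) * (1 + lam * (- c) + 16 * lam\<^sup>2)"
      using drift[OF z True] lam_pos by (intro mult_left_mono add_mono) auto
    also have "\<dots> = (1 - rho) * exp (lam * Y z)"
      by (simp add: lam_def rho_def power2_eq_square algebra_simps)
    finally show ?thesis by simp
  next
    case False
    have "?E (\<lambda>z'. exp (lam * Y z')) \<le> ?E (\<lambda>z'. 2)"
    proof (intro integral_mono_AE integrable_K z, unfold AE_measure_pmf_iff, rule ballI)
      fix z' assume z': "z' \<in> set_pmf (K z)"
      have "lam * Y z' \<le> lam * 4" using jump[OF z z'] False lam_pos by (intro mult_left_mono) auto
      then have "exp (lam * Y z') \<le> exp (1/8)" using small by simp
      also have "\<dots> \<le> 1 + 1/8 + (1/8)\<^sup>2" by (rule exp_le_quadratic) simp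
      finally show "exp (lam * Y z') \<le> 2" by (simp add: power2_eq_square)
    qed
    also have "\<dots> \<le> (1 - rho) * exp (lam * Y z) + 2" using rho_le by simp
    finally show ?thesis .
  qed
qed

text \<open>The last hypothesis is the burn-in condition: by time \<open>t\<close> the factor
  \<open>(1 - rho) ^ t\<close> has cancelled the largest initial value
  \<open>exp (lam * m)\<close>.\<close>

lemma path_sum_exp_le:
  assumes "x \<in> S" "Y x \<le> m" "lam * m \<le> rho * real t"
  shows "path_sum K S x t (\<lambda>h. exp (lam * Y (h t))) \<le> 1 + 2 / rho"
proof -
  have "path_sum K S x t (\<lambda>h. exp (lam * Y (h t))) \<le> (1 - rho) ^ t * exp (lam * Y x) + 2 / rho"
    using assms rho_pos rho_le expectation_exp
    by (intro path_sum_contraction[where W = "\<lambda>z. exp (lam * Y z)"]) auto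
  moreover have "(1 - rho) ^ t * exp (lam * Y x) \<le> 1"
  proof -
    have "(1 - rho) ^ t \<le> exp (- rho) ^ t"
      using exp_ge_add_one_self[of "- rho"] rho_le by (intro power_mono) auto
    also have "\<dots> = exp (- (rho * real t))" by (simp add: mult.commute flip: exp_of_nat_mult)
    finally have "(1 - rho) ^ t * exp (lam * Y x) \<le> exp (- (rho * real t)) * exp (lam * m)"
      using assms lam_pos rho_le by (intro mult_mono) auto
    also have "\<dots> \<le> 1" using assms(3) by (simp flip: exp_add)
    finally show ?thesis .
  qed
  ultimately show ?thesis by simp
qed

text \<open>Markov's inequality for \<open>exp (lam * Y)\<close> at the level
  \<open>exp (lam * b)\<close>, after the burn-in.\<close>

lemma prob_large:
  assumes "x \<in> S" "Y x \<le> m" "lam * m \<le> rho * real t"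
    and bad: "\<And>z. z \<in> S \<Longrightarrow> bad z \<Longrightarrow> b \<le> Y z"
  shows "measure (markov_chain K x) {\<omega>. bad (\<omega> t)} \<le> (1 + 2 / rho) * exp (- (lam * b))"
proof -
  have "measure (markov_chain K x) {\<omega>. bad (\<omega> t)} \<le>
      path_sum K S x t (\<lambda>h. exp (- (lam * b)) * exp (lam * Y (h t)))"
  proof (rule prob_le_path_sum)
    note pred_component_count_space[where P = bad, measurable]
    have "{\<omega> \<in> space (markov_chain K x). bad (\<omega> t)} \<in> sets (markov_chain K x)" by measurable
    then show "{\<omega>. bad (\<omega> t)} \<in> sets (markov_chain K x)" by simp
    fix h \<omega> assume "h \<in> {..t} \<rightarrow>\<^sub>E S" "\<omega> \<in> {\<omega>. bad (\<omega> t)}" "\<forall>i\<le>t. \<omega> i = h i"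
    then have "b \<le> Y (h t)" by (intro bad) auto
    then show "1 \<le> exp (- (lam * b)) * exp (lam * Y (h t))"
      using lam_pos by (simp flip: exp_add)
  qed (use assms in auto)
  also have "\<dots> \<le> exp (- (lam * b)) * (1 + 2 / rho)"
    unfolding path_sum_cmult using path_sum_exp_le[OF assms(1-3)] by (intro mult_left_mono) auto
  finally show ?thesis by (simp add: mult.commute)
qed

section \<open>Exponential bounds on the number of failures\<close>

definition "qq = 1 - rho / 2"

lemma qq: "1/2 \<le> qq" "0 < qq" "qq < 1"
  using rho_pos rho_le by (auto simp: qq_def)

text \<open>The choice of \<open>\<zeta>\<close> balances two demands. The additive error
  \<open>2 * \<zeta>\<close> is exponentially small in \<open>b\<close>, while at a bad state the
  exponential term is still at least \<open>exp (lam * b / 2)\<close>, hence at least half of the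
  potential. So half of the contraction \<open>rho\<close> survives there, which gives the factor
  \<open>qq\<close>.\<close>

lemma expectation_potential:
  assumes z: "z \<in> S" and b: "0 \<le> b" and "lam * b \<ge> 2"
    and bad: "\<And>z. z \<in> S \<Longrightarrow> bad z \<Longrightarrow> b \<le> Y z"
  defines "\<zeta> \<equiv> exp (- (lam * b / 2))"
  shows "(if bad z then 1 / qq else 1) *
      measure_pmf.expectation (K z) (\<lambda>z'. 1 + \<zeta> * exp (lam * Y z')) \<le>
      (1 + 4 * \<zeta>) * (1 + \<zeta> * exp (lam * Y z))"
proof -
  let ?V = "\<lambda>z. 1 + \<zeta> * exp (lam * Y z)"
  have \<zeta>: "0 < \<zeta>" by (simp add: \<zeta>_def)
  have V1: "1 \<le> ?V z" using \<zeta> by simp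
  have "measure_pmf.expectation (K z) ?V =
      1 + \<zeta> * measure_pmf.expectation (K z) (\<lambda>z'. exp (lam * Y z'))"
    using integrable_K[OF z] by simp
  also have "\<dots> \<le> 1 + \<zeta> * ((1 - rho) * exp (lam * Y z) + 2)"
    using expectation_exp[OF z] \<zeta> by simp
  also have "\<dots> = ?V z + 2 * \<zeta> - rho * (?V z - 1)" by (simp add: algebra_simps)
  finally have E: "measure_pmf.expectation (K z) ?V \<le> ?V z + 2 * \<zeta> - rho * (?V z - 1)" .
  show ?thesis
  proof (cases "bad z")
    case False
    have "measure_pmf.expectation (K z) ?V \<le> ?V z + 2 * \<zeta>"
    proof -
      have "0 \<le> rho * (?V z - 1)" using rho_pos V1 by (intro mult_nonneg_nonneg) linarith+
      with E show ?thesis by linarith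
    qed
    also have "\<dots> \<le> (1 + 4 * \<zeta>) * ?V z"
    proof -
      have "\<zeta> * 1 \<le> \<zeta> * ?V z" using V1 \<zeta> by (intro mult_left_mono) auto
      then show ?thesis using \<zeta> by (simp only: ring_distribs)
    qed
    finally show ?thesis using False by simp
  next
    case True
    have "2 \<le> ?V z"
    proof -
      have "lam * b \<le> lam * Y z" using bad[OF z True] lam_pos by simp
      moreover have "\<zeta> * exp (lam * Y z) = exp (lam * Y z - lam * b / 2)"
        by (simp add: \<zeta>_def flip: exp_add)
      ultimately show ?thesis using assms(3) by simp
    qed
    then have "rho * (?V z / 2) \<le> rho * (?V z - 1)" using rho_pos by (intro mult_left_mono) simp_all
    then have "measure_pmf.expectation (K z) ?V \<le> ?V z + 2 * \<zeta> - rho * (?V z / 2)" using E by linarith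
    also have "\<dots> = qq * ?V z + 2 * \<zeta>" by (simp add: qq_def algebra_simps)
    also have "\<dots> \<le> qq * ((1 + 4 * \<zeta>) * ?V z)"
    proof -
      \<comment> \<open>The bound \<open>qq \<ge> 1/2\<close> lets \<open>qq * 4 * \<zeta>\<close>
        absorb the error \<open>2 * \<zeta>\<close>; hence the 4 in the growth factor.\<close>
      have "1/2 * (4 * \<zeta> * 1) \<le> qq * (4 * \<zeta> * ?V z)"
        using V1 \<zeta> qq by (intro mult_mono) auto
      then show ?thesis by (simp only: ring_distribs)
    qed
    finally show ?thesis using True qq by (simp add: field_simps)
  qed
qed

text \<open>Every failure gains a factor \<open>1 / qq\<close>, so more than
  \<open>\<epsilon> * t\<close> of them gain at least \<open>qq powr (- (\<epsilon> * t))\<close>.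
  By the last hypothesis half of this exponent pays for the growth per step; the other half is the
  rate of decay.\<close>

lemma prob_many_failures:
  assumes x: "x \<in> S" and b: "0 \<le> b" "lam * b \<ge> 2"
    and bad: "\<And>z. z \<in> S \<Longrightarrow> bad z \<Longrightarrow> b \<le> Y z"
    and st: "s \<le> t" and \<epsilon>: "0 < \<epsilon>"
    and \<kappa>: "1 + 4 * exp (- (lam * b / 2)) \<le> qq powr (- (\<epsilon> / 2))"
  shows "measure (markov_chain K x) {\<omega>. \<epsilon> * real t < real (card {i\<in>{s..t}. bad (\<omega> i)})} \<le>
    5 * path_sum K S x s (\<lambda>h. 1 + exp (- (lam * b / 2)) * exp (lam * Y (h s))) * (qq powr (\<epsilon> / 2)) ^ t"
proof -
  define \<zeta> where "\<zeta> = exp (- (lam * b / 2))"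
  define V where "V z = 1 + \<zeta> * exp (lam * Y z)" for z
  define u where "u z = (if bad z then 1 / qq else 1)" for z
  have \<zeta>: "0 < \<zeta>" "\<zeta> \<le> 1" using b by (auto simp: \<zeta>_def)
  have u: "0 \<le> u z" for z using qq by (simp add: u_def)
  have V: "1 \<le> V z" for z using \<zeta> by (simp add: V_def)
  define q where "q = qq powr (\<epsilon> * real t)"
  have q0: "0 < q" using qq by (simp add: q_def)
  define r where "r = qq powr (\<epsilon> / 2)"
  define p where "p = path_sum K S x s (\<lambda>h. V (h s))"
  have r: "0 \<le> r" by (simp add: r_def)
  have p: "0 \<le> p" unfolding p_def using order.trans[OF zero_le_one V] by (intro path_sum_nonneg)
  have \<kappa>1: "(1 + 4 * \<zeta>) * r \<le> 1"
    using mult_right_mono[OF \<kappa>, of r] qq r by (simp add: \<zeta>_def r_def flip: powr_add)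
  let ?bad = "{\<omega>. \<epsilon> * real t < real (card {i\<in>{s..t}. bad (\<omega> i)})}"
  \<comment> \<open>The horizon is \<open>Suc t\<close> so that the product covers the state at time
    \<open>t\<close>. The additional step costs one factor \<open>1 + 4 * \<zeta>\<close>, which is
    at most 5.\<close>
  have "measure (markov_chain K x) ?bad \<le>
      path_sum K S x (Suc t) (\<lambda>h. q * ((\<Prod>i\<in>{s..<Suc t}. u (h i)) * V (h (Suc t))))"
  proof (rule prob_le_path_sum)
    show "?bad \<in> sets (markov_chain K x)" by (rule sets_failure_count)
    fix h \<omega>
    show "0 \<le> q * ((\<Prod>i\<in>{s..<Suc t}. u (h i)) * V (h (Suc t)))"
      using u V[of "h (Suc t)"] q0 by (intro mult_nonneg_nonneg prod_nonneg) auto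
    assume h: "\<omega> \<in> ?bad" "\<forall>i\<le>Suc t. \<omega> i = h i"
    let ?N = "{i\<in>{s..t}. bad (\<omega> i)}"
    have "(\<Prod>i\<in>{s..<Suc t}. u (h i)) = (\<Prod>i\<in>{s..t}. if bad (\<omega> i) then 1 / qq else 1)"
      using h(2) by (intro prod.cong) (simp_all add: u_def atLeastLessThanSuc_atLeastAtMost)
    also have "\<dots> = (1 / qq) ^ card ?N"
      by (simp add: prod.If_cases Int_def)
    also have "\<dots> = qq powr (- real (card ?N))"
      using qq by (simp add: powr_minus powr_realpow power_one_over inverse_eq_divide)
    finally have prod: "(\<Prod>i\<in>{s..<Suc t}. u (h i)) = qq powr (- real (card ?N))" .
    have "1 \<le> qq powr (\<epsilon> * real t - real (card ?N))"
      using qq h(1) powr_mono'[of "\<epsilon> * real t - real (card ?N)" 0 qq] by simp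
    also have "\<dots> = q * qq powr (- real (card ?N))" by (simp add: q_def flip: powr_add)
    also have "\<dots> = q * (qq powr (- real (card ?N)) * 1)" by simp
    also have "\<dots> \<le> q * (qq powr (- real (card ?N)) * V (h (Suc t)))"
      using q0 V by (intro mult_left_mono) auto
    finally show "1 \<le> q * ((\<Prod>i\<in>{s..<Suc t}. u (h i)) * V (h (Suc t)))"
      unfolding prod .
  qed (rule x)
  also have "\<dots> \<le> q * ((1 + 4 * \<zeta>) ^ (Suc t - s) * p)"
    unfolding path_sum_cmult p_def
  proof (intro mult_left_mono path_sum_multiplicative)
    show "u z * measure_pmf.expectation (K z) V \<le> (1 + 4 * \<zeta>) * V z" if "z \<in> S" for z
      using expectation_potential[OF that b bad] by (simp add: u_def V_def[abs_def] \<zeta>_def)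
  qed (use \<zeta> st q0 u in simp_all)
  also have "\<dots> \<le> q * ((1 + 4 * \<zeta>) ^ Suc t * p)"
    using \<zeta> q0 p by (intro mult_left_mono mult_right_mono power_increasing) simp_all
  also have "q = r ^ t * r ^ t"
    using qq by (simp add: q_def r_def powr_power flip: powr_add)
  also have "r ^ t * r ^ t * ((1 + 4 * \<zeta>) ^ Suc t * p) =
      ((1 + 4 * \<zeta>) * r) ^ t * ((1 + 4 * \<zeta>) * p * r ^ t)"
    by (simp add: power_mult_distrib)
  also have "\<dots> \<le> 1 * (5 * p * r ^ t)"
  proof (rule mult_mono)
    show "((1 + 4 * \<zeta>) * r) ^ t \<le> 1"
      using \<kappa>1 \<zeta> r by (intro power_le_one mult_nonneg_nonneg) simp_all
    show "(1 + 4 * \<zeta>) * p * r ^ t \<le> 5 * p * r ^ t"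
      using \<zeta> p r by (intro mult_right_mono zero_le_power) simp_all
  qed (use \<zeta> p r in simp_all)
  finally show ?thesis by (simp add: p_def r_def V_def[abs_def] \<zeta>_def)
qed

end

lemma exp_neg_linear_tendsto_0: "0 < a \<Longrightarrow> (\<lambda>n. exp (- (a * real n))) \<longlonglongrightarrow> 0"
  using LIMSEQ_power_zero[of "exp (- a)"] by (simp add: mult.commute flip: exp_of_nat_mult)

context drift_chain
begin

text \<open>A union bound over all end times \<open>k + s\<close>, summed as a geometric series. The
  burn-in condition bounds the path sum at time \<open>s\<close> by a constant independent of the
  start.\<close>

lemma long_run_prob:
  assumes x: "x \<in> S" and m: "Y x \<le> m" "lam * m \<le> rho * real s" and b: "0 \<le> b" "lam * b \<ge> 2"
    and bad: "\<And>z. z \<in> S \<Longrightarrow> bad z \<Longrightarrow> b \<le> Y z" and \<epsilon>: "0 < \<epsilon>"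
    and \<kappa>: "1 + 4 * exp (- (lam * b / 2)) \<le> qq powr (- (\<epsilon> / 2))"
  defines "r \<equiv> qq powr (\<epsilon> / 2)"
  shows "measure (markov_chain K x) (\<Union>k. {\<omega>. \<epsilon> * real (k + s) < real (card {i\<in>{s..k + s}. bad (\<omega> i)})})
    \<le> 5 * (2 + 2 / rho) * r ^ s / (1 - r)"
proof -
  let ?M = "markov_chain K x"
  interpret prob_space ?M by (rule prob_space_markov_chain)
  let ?A = "\<lambda>k. {\<omega>. \<epsilon> * real (k + s) < real (card {i\<in>{s..k + s}. bad (\<omega> i)})}"
  have r: "0 < r" "r < 1" using qq \<epsilon> by (auto simp: r_def powr01_less_one)
  have "path_sum K S x s (\<lambda>h. 1 + exp (- (lam * b / 2)) * exp (lam * Y (h s))) =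
      1 + exp (- (lam * b / 2)) * path_sum K S x s (\<lambda>h. exp (lam * Y (h s)))"
    by (simp add: path_sum_add path_sum_cmult path_sum_one x)
  also have "\<dots> \<le> 1 + 1 * (1 + 2 / rho)"
    using path_sum_exp_le[OF x m] b rho_pos
    by (intro add_mono mult_mono path_sum_nonneg) auto
  finally have p: "path_sum K S x s (\<lambda>h. 1 + exp (- (lam * b / 2)) * exp (lam * Y (h s))) \<le> 2 + 2 / rho"
    by simp
  have A: "prob (?A k) \<le> 5 * (2 + 2 / rho) * r ^ s * r ^ k" for k
  proof -
    have "prob (?A k) \<le>
        5 * path_sum K S x s (\<lambda>h. 1 + exp (- (lam * b / 2)) * exp (lam * Y (h s))) * r ^ (k + s)"
      unfolding r_def by (rule prob_many_failures[OF x b bad _ \<epsilon> \<kappa>]) simp_all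
    also have "\<dots> \<le> 5 * (2 + 2 / rho) * r ^ (k + s)"
      using p r by (intro mult_right_mono mult_left_mono) simp_all
    finally show ?thesis by (simp add: power_add mult_ac)
  qed
  have S: "summable (\<lambda>k. 5 * (2 + 2 / rho) * r ^ s * r ^ k)"
    using r by (intro summable_mult summable_geometric) simp
  have S': "summable (\<lambda>k. prob (?A k))"
    by (rule summable_comparison_test'[OF S, of 0]) (use A in simp)
  have "prob (\<Union>k. ?A k) \<le> (\<Sum>k. prob (?A k))"
    by (rule finite_measure_subadditive_countably[OF image_subsetI[OF sets_failure_count] S'])
  also have "\<dots> \<le> (\<Sum>k. 5 * (2 + 2 / rho) * r ^ s * r ^ k)"
    by (intro suminf_le A S S')
  also have "\<dots> = 5 * (2 + 2 / rho) * r ^ s * (1 / (1 - r))"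
    using r by (subst suminf_mult) (auto intro: summable_geometric simp: suminf_geometric)
  finally show ?thesis by simp
qed

text \<open>Counting starts at time 1, before any burn-in, so the path sum \<open>p\<close> may be
  huge. It does not depend on \<open>t\<close>, however, and the bounds remain summable, as
  Borel-Cantelli requires.\<close>

lemma long_run_AE:
  assumes x: "x \<in> S" and b: "0 \<le> b" "lam * b \<ge> 2"
    and bad: "\<And>z. z \<in> S \<Longrightarrow> bad z \<Longrightarrow> b \<le> Y z" and \<epsilon>: "0 < \<epsilon>"
    and \<kappa>: "1 + 4 * exp (- (lam * b / 2)) \<le> qq powr (- (\<epsilon> / 2))"
  shows "AE \<omega> in markov_chain K x. \<forall>\<^sub>F t in sequentially.
    real (card {i\<in>{1..t}. bad (\<omega> i)}) \<le> \<epsilon> * real t"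
proof -
  let ?M = "markov_chain K x"
  interpret prob_space ?M by (rule prob_space_markov_chain)
  let ?A = "\<lambda>t. {\<omega>. \<epsilon> * real t < real (card {i\<in>{1..t}. bad (\<omega> i)})}"
  define r where "r = qq powr (\<epsilon> / 2)"
  have r: "0 < r" "r < 1" using qq \<epsilon> by (auto simp: r_def powr01_less_one)
  define p where "p = path_sum K S x 1 (\<lambda>h. 1 + exp (- (lam * b / 2)) * exp (lam * Y (h 1)))"
  have A: "prob (?A t) \<le> 5 * p * r ^ t" if "1 \<le> t" for t
    unfolding p_def r_def by (rule prob_many_failures[OF x b bad that \<epsilon> \<kappa>])
  have "summable (\<lambda>t. prob (?A t))"
    by (rule summable_comparison_test'[of "\<lambda>t. 5 * p * r ^ t" 1])
      (use A r in \<open>auto intro!: summable_mult summable_geometric\<close>)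
  then have "AE \<omega> in ?M. \<forall>\<^sub>F t in sequentially. \<omega> \<in> space ?M - ?A t"
    by (intro borel_cantelli_AE1 sets_failure_count) (auto simp: emeasure_eq_measure)
  then show ?thesis
    by eventually_elim (auto elim!: eventually_mono)
qed

end

section \<open>Families of chains with drift uniform in \<open>n\<close>\<close>

locale drift_family =
  fixes K :: "nat \<Rightarrow> 'a \<Rightarrow> 'a pmf" and S :: "nat \<Rightarrow> 'a set" and Y :: "nat \<Rightarrow> 'a \<Rightarrow> real"
    and bad :: "nat \<Rightarrow> 'a \<Rightarrow> bool" and c \<delta> :: real
  assumes c0: "0 < c" and \<delta>0: "0 < \<delta>"
    and chain: "\<forall>\<^sub>F n in sequentially. drift_chain (K n) (S n) (Y n) c"
    and Y_le: "\<And>n z. z \<in> S n \<Longrightarrow> Y n z \<le> real n"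
    and bad: "\<And>n z. z \<in> S n \<Longrightarrow> bad n z \<Longrightarrow> \<delta> * real n \<le> Y n z"
begin

text \<open>Since \<open>lam / rho = 2 / c\<close> and \<open>Y \<le> n\<close>, times from
  \<open>2 / c * n\<close> on satisfy the burn-in condition. The added 1 pays for rounding down and
  ensures \<open>C \<ge> 1\<close>.\<close>

abbreviation "C \<equiv> 2 / c + 1"

lemma burn_in:
  assumes "2 / c * real n \<le> t"
  shows "c / 32 * real n \<le> c\<^sup>2 / 64 * t"
proof -
  have "c / 32 * real n = c\<^sup>2 / 64 * (2 / c * real n)"
    using c0 by (simp add: power2_eq_square)
  also have "\<dots> \<le> c\<^sup>2 / 64 * t" using assms by (intro mult_left_mono) auto
  finally show ?thesis .
qed

text \<open>The start has \<open>Y\<close> at most \<open>n\<close> and a failure has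
  \<open>Y\<close> at least \<open>\<delta> * n\<close>, so \<open>prob_large\<close> after the
  burn-in gives a bound exponentially small in \<open>n\<close>, for all starts at once.\<close>

lemma eventually_prob_bad_le:
  assumes "0 < \<epsilon>"
  shows "\<forall>\<^sub>F n in sequentially. \<forall>x\<in>S n.
    measure (markov_chain (K n) x) {\<omega>. bad n (\<omega> (nat \<lfloor>C * real n\<rfloor>))} \<le> \<epsilon>"
proof -
  define L where "L = c / 32 * \<delta>"
  have L: "0 < L" using c0 \<delta>0 by (simp add: L_def)
  have "(\<lambda>n. (1 + 2 / (c\<^sup>2 / 64)) * exp (- (L * real n))) \<longlonglongrightarrow> (1 + 2 / (c\<^sup>2 / 64)) * 0"
    by (intro tendsto_intros exp_neg_linear_tendsto_0 L)
  then have "\<forall>\<^sub>F n in sequentially. (1 + 2 / (c\<^sup>2 / 64)) * exp (- (L * real n)) < \<epsilon>"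
    using assms by (intro order_tendstoD) auto
  then show ?thesis
    using chain eventually_ge_at_top[of 1]
  proof eventually_elim
    case (elim n)
    interpret drift_chain "K n" "S n" "Y n" c by (rule elim)
    show ?case
    proof
      fix x assume x: "x \<in> S n"
      have "2 / c * real n \<le> real (nat \<lfloor>C * real n\<rfloor>)"
      proof -
        have "2 / c * real n + 1 \<le> C * real n" using elim(3) by (simp add: algebra_simps)
        also have "C * real n < real_of_int \<lfloor>C * real n\<rfloor> + 1" by linarith
        also have "real_of_int \<lfloor>C * real n\<rfloor> \<le> real (nat \<lfloor>C * real n\<rfloor>)" by linarith
        finally show ?thesis by simp
      qed
      from burn_in[OF this]
      have "measure (markov_chain (K n) x) {\<omega>. bad n (\<omega> (nat \<lfloor>C * real n\<rfloor>))} \<le>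
          (1 + 2 / rho) * exp (- (lam * (\<delta> * real n)))"
        by (intro prob_large[OF x Y_le[OF x]] bad) (simp_all add: lam_def rho_def)
      also have "\<dots> \<le> \<epsilon>" using elim(1) by (simp add: L_def lam_def rho_def mult_ac)
      finally show "measure (markov_chain (K n) x) {\<omega>. bad n (\<omega> (nat \<lfloor>C * real n\<rfloor>))} \<le> \<epsilon>" .
    qed
  qed
qed

lemma eventually_long_run:
  assumes \<epsilon>: "0 < \<epsilon>"
  shows "\<forall>\<^sub>F n in sequentially. \<forall>x\<in>S n.
    measure (markov_chain (K n) x) {\<omega>. \<forall>t::nat. C * real n \<le> real t \<longrightarrow>
      real (card {s\<in>{1..t}. C * real n \<le> real s \<and> bad n (\<omega> s)}) \<le> \<epsilon> * real t} \<ge> 1 - \<epsilon> \<and>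
    (AE \<omega> in markov_chain (K n) x. \<forall>\<^sub>F t in sequentially.
      real (card {s\<in>{1..t}. bad n (\<omega> s)}) \<le> \<epsilon> * real t)"
proof -
  \<comment> \<open>This bound belongs to the individual chains, which are available for large
    \<open>n\<close> only; a single such \<open>n\<close> supplies it.\<close>
  have c1: "c \<le> 1"
    using eventually_happens[OF chain] by (auto simp: drift_chain_def drift_chain_axioms_def)
  define L where "L = c / 32 * \<delta>"
  have L: "0 < L" using c0 \<delta>0 by (simp add: L_def)
  define q where "q = 1 - c\<^sup>2 / 64 / 2"
  have q: "0 < q" "q < 1" using c0 c1 power_le_one[of c 2] by (auto simp: q_def field_simps)
  define r where "r = q powr (\<epsilon> / 2)"
  have r: "0 < r" "r < 1" using q \<epsilon> by (auto simp: r_def powr01_less_one)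
  define D where "D = 5 * (2 + 2 / (c\<^sup>2 / 64)) / (1 - r)"
  have D: "0 \<le> D" using r by (simp add: D_def)
  have "(\<lambda>n. 1 + 4 * exp (- (L / 2 * real n))) \<longlonglongrightarrow> 1 + 4 * 0"
    by (intro tendsto_intros exp_neg_linear_tendsto_0) (use L in simp)
  moreover have "1 < q powr (- (\<epsilon> / 2))"
    using r by (simp add: r_def powr_minus one_less_inverse)
  ultimately have "\<forall>\<^sub>F n in sequentially. 1 + 4 * exp (- (L / 2 * real n)) < q powr (- (\<epsilon> / 2))"
    by (intro order_tendstoD) simp_all
  moreover have "(\<lambda>n. D * r ^ n) \<longlonglongrightarrow> D * 0"
    using r by (intro tendsto_intros LIMSEQ_power_zero) simp
  then have "\<forall>\<^sub>F n in sequentially. D * r ^ n < \<epsilon>"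
    using \<epsilon> by (intro order_tendstoD) simp_all
  moreover have "\<forall>\<^sub>F n in sequentially. 2 / L \<le> real n"
    by (rule eventually_compose_filterlim[OF eventually_ge_at_top filterlim_real_sequentially])
  ultimately show ?thesis
    using chain eventually_ge_at_top[of 1]
  proof eventually_elim
    case (elim n)
    interpret drift_chain "K n" "S n" "Y n" c by (rule elim)
    have eqs: "qq = q" "lam * (\<delta> * real n) = L * real n"
      by (simp_all add: qq_def rho_def q_def lam_def L_def)
    have b: "0 \<le> \<delta> * real n" "2 \<le> lam * (\<delta> * real n)"
      using \<delta>0 elim(3) L unfolding eqs by (simp_all add: field_simps)
    have \<kappa>: "1 + 4 * exp (- (lam * (\<delta> * real n) / 2)) \<le> qq powr (- (\<epsilon> / 2))"
      using elim(1) unfolding eqs by simp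
    \<comment> \<open>The least integer time not below \<open>C * real n\<close>.\<close>
    define s where "s = nat \<lceil>C * real n\<rceil>"
    have s: "C * real n \<le> real s" unfolding s_def by linarith
    have Cn: "real n \<le> C * real n" using c0 by (simp add: algebra_simps)
    show ?case
    proof (intro ballI conjI)
      fix x assume x: "x \<in> S n"
      let ?M = "markov_chain (K n) x"
      interpret P: prob_space ?M by (rule prob_space_markov_chain)
      show "AE \<omega> in ?M. \<forall>\<^sub>F t in sequentially. real (card {s\<in>{1..t}. bad n (\<omega> s)}) \<le> \<epsilon> * real t"
        by (rule long_run_AE[OF x b bad \<epsilon> \<kappa>])
      let ?U = "\<Union>k. {\<omega>. \<epsilon> * real (k + s) < real (card {i\<in>{s..k + s}. bad n (\<omega> i)})}"
      let ?G = "{\<omega>. \<forall>t::nat. C * real n \<le> real t \<longrightarrow>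
        real (card {s\<in>{1..t}. C * real n \<le> real s \<and> bad n (\<omega> s)}) \<le> \<epsilon> * real t}"
      have U: "?U \<in> sets ?M" by (rule sets.countable_UN[OF image_subsetI[OF sets_failure_count]])
      have "2 / c * real n \<le> real s"
        using s by (simp add: algebra_simps)
      from burn_in[OF this] have lm: "lam * real n \<le> rho * real s"
        by (simp add: lam_def rho_def)
      have "P.prob ?U \<le> 5 * (2 + 2 / rho) * (qq powr (\<epsilon> / 2)) ^ s / (1 - qq powr (\<epsilon> / 2))"
        by (rule long_run_prob[OF x Y_le[OF x] lm b bad \<epsilon> \<kappa>])
      also have "\<dots> = D * r ^ s" by (simp add: D_def r_def eqs rho_def)
      also have "\<dots> \<le> D * r ^ n"
        using D r s Cn by (intro mult_left_mono power_decreasing) linarith+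
      finally have "P.prob ?U \<le> \<epsilon>" using elim(2) by simp
      then have "1 - \<epsilon> \<le> P.prob (space ?M - ?U)" using P.prob_compl[OF U] by simp
      also have "\<dots> \<le> P.prob ?G"
      proof (rule P.finite_measure_mono)
        show "space ?M - ?U \<subseteq> ?G"
        proof (intro subsetI CollectI allI impI)
          fix \<omega> t assume \<omega>: "\<omega> \<in> space ?M - ?U" and t: "C * real n \<le> real t"
          have st: "s \<le> t" using t unfolding s_def by linarith
          have "card {i\<in>{1..t}. C * real n \<le> real i \<and> bad n (\<omega> i)} \<le> card {i\<in>{s..t}. bad n (\<omega> i)}"
            by (rule card_mono) (auto simp: s_def nat_le_iff ceiling_le_iff)
          moreover have "real (card {i\<in>{s..(t - s) + s}. bad n (\<omega> i)}) \<le> \<epsilon> * real ((t - s) + s)"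
            using \<omega> not_less by blast
          ultimately show "real (card {i\<in>{1..t}. C * real n \<le> real i \<and> bad n (\<omega> i)}) \<le> \<epsilon> * real t"
            using st by simp
        qed
        \<comment> \<open>Measurability of \<open>?G\<close>: the times counted form an interval, so
          \<open>?G\<close> is the complement of a countable union of events covered by
          \<open>sets_failure_count\<close>.\<close>
        have "?G = {\<omega> \<in> space ?M. \<forall>t::nat. C * real n \<le> real t \<longrightarrow>
            \<not> \<epsilon> * real t < real (card {i\<in>{1..t}. C * real n \<le> real i \<and> bad n (\<omega> i)})}"
          by (simp add: not_less)
        also have "\<dots> = {\<omega> \<in> space ?M. \<forall>t::nat. C * real n \<le> real t \<longrightarrow>
            \<not> \<epsilon> * real t < real (card {i\<in>{max 1 s..t}. bad n (\<omega> i)})}"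
        proof -
          have "{i\<in>{1..t}. C * real n \<le> real i \<and> bad n (\<omega> i)} = {i\<in>{max 1 s..t}. bad n (\<omega> i)}" for t \<omega>
            by (auto simp: s_def nat_le_iff ceiling_le_iff)
          then show ?thesis by simp
        qed
        also have "\<dots> = space ?M - (\<Union>t\<in>{t. C * real n \<le> real t}.
            {\<omega>. \<epsilon> * real t < real (card {i\<in>{max 1 s..t}. bad n (\<omega> i)})})"
          by auto
        also have "\<dots> \<in> sets ?M"
          by (intro sets.Diff sets.top sets.countable_UN'' sets_failure_count countableI_type)
        finally show "?G \<in> sets ?M" .
      qed
      finally show "1 - \<epsilon> \<le> P.prob ?G" .
    qed
  qed
qed

end


section \<open>Switches in cubic graphs\<close>

lemma neighbours_iff: "u \<in> neighbours E v \<longleftrightarrow> {u, v} \<in> E"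
  by (simp add: neighbours_def)

lemma neighbours_commute: "u \<in> neighbours E v \<longleftrightarrow> v \<in> neighbours E u"
  by (simp add: neighbours_def insert_commute)

definition triangles_on :: "graph \<Rightarrow> nat set \<Rightarrow> nat set set" where
  "triangles_on E e = {T \<in> triangles E. e \<subseteq> T}"

text \<open>Both kinds of moves are instances of a switch: \<open>make(yxvwz)\<close> replaces \<open>xy, wz\<close> by \<open>xw, yz\<close>,
  and \<open>break(vxw, yz)\<close> replaces \<open>xw, yz\<close> by \<open>xy, wz\<close>.\<close>

definition switch :: "graph \<Rightarrow> nat \<Rightarrow> nat \<Rightarrow> nat \<Rightarrow> nat \<Rightarrow> graph" where
  "switch E a b c d = (E - {{a, b}, {c, d}}) \<union> {{a, c}, {b, d}}"

definition switchable :: "graph \<Rightarrow> nat \<Rightarrow> nat \<Rightarrow> nat \<Rightarrow> nat \<Rightarrow> bool" where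
  "switchable E a b c d \<longleftrightarrow>
     distinct [a, b, c, d] \<and> {a, b} \<in> E \<and> {c, d} \<in> E \<and> {a, c} \<notin> E \<and> {b, d} \<notin> E"

lemma make_eq_switch: "make E y x v w z = switch E x y w z"
  by (simp add: make_def switch_def)

lemma break_eq_switch: "break E v x w y z = switch E x w y z"
  by (simp add: break_def switch_def)

lemma neighbours_switch:
  assumes "switchable E a b c d"
  shows "neighbours (switch E a b c d) v =
    (if v = a then insert c (neighbours E a - {b})
     else if v = b then insert d (neighbours E b - {a})
     else if v = c then insert a (neighbours E c - {d})
     else if v = d then insert b (neighbours E d - {c})
     else neighbours E v)"
  using assms by (auto simp: neighbours_def switch_def switchable_def doubleton_eq_iff)

text \<open>A triangle of the new graph that avoids both new edges consists of surviving old
  edges.\<close>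

lemma triangles_switch_subset:
  "triangles (switch E a b c d) \<subseteq>
     (triangles E - (triangles_on E {a, b} \<union> triangles_on E {c, d})) \<union>
     (triangles_on (switch E a b c d) {a, c} \<union> triangles_on (switch E a b c d) {b, d})"
  if "switchable E a b c d"
proof
  fix T assume T: "T \<in> triangles (switch E a b c d)"
  show "T \<in> (triangles E - (triangles_on E {a, b} \<union> triangles_on E {c, d})) \<union>
     (triangles_on (switch E a b c d) {a, c} \<union> triangles_on (switch E a b c d) {b, d})"
  proof (cases "{a, c} \<subseteq> T \<or> {b, d} \<subseteq> T")
    case True
    then show ?thesis using T by (auto simp: triangles_on_def)
  next
    case False
    have *: "{u, v} \<in> E - {{a, b}, {c, d}}" if "u \<in> T" "v \<in> T" "u \<noteq> v" for u v
    proof -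
      have "{u, v} \<in> switch E a b c d" using T that by (auto simp: triangles_def)
      moreover have "{u, v} \<noteq> {a, c}" "{u, v} \<noteq> {b, d}" using that False by auto
      ultimately show ?thesis by (auto simp: switch_def)
    qed
    have "T \<in> triangles E" using T * by (auto simp: triangles_def)
    moreover have "\<not> {a, b} \<subseteq> T" using *[of a b] that by (auto simp: switchable_def)
    moreover have "\<not> {c, d} \<subseteq> T" using *[of c d] that by (auto simp: switchable_def)
    ultimately show ?thesis by (auto simp: triangles_on_def)
  qed
qed

lemma triangles_diff_subset_switch:
  "triangles E - (triangles_on E {a, b} \<union> triangles_on E {c, d}) \<subseteq> triangles (switch E a b c d)"
proof
  fix T assume T: "T \<in> triangles E - (triangles_on E {a, b} \<union> triangles_on E {c, d})"
  have "{u, v} \<in> switch E a b c d" if "u \<in> T" "v \<in> T" "u \<noteq> v" for u v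
  proof -
    have "{u, v} \<in> E" using T that by (auto simp: triangles_def)
    moreover have "{u, v} \<noteq> {a, b}" "{u, v} \<noteq> {c, d}" using T that by (auto simp: triangles_on_def)
    ultimately show ?thesis by (auto simp: switch_def)
  qed
  then show "T \<in> triangles (switch E a b c d)" using T by (auto simp: triangles_def)
qed

section \<open>Triangles of a cubic graph and the effect of a switch on them\<close>

locale cubic_graph =
  fixes n :: nat and E :: graph
  assumes cubic: "E \<in> cubic_graphs n"
begin

abbreviation "N \<equiv> neighbours E"

lemma edge_subset: "e \<in> E \<Longrightarrow> e \<subseteq> {1..n}" and card_edge: "e \<in> E \<Longrightarrow> card e = 2"
  using cubic by (auto simp: cubic_graphs_def)

lemma neighbours_subset: "N v \<subseteq> {1..n}" and finite_neighbours [simp]: "finite (N v)"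
proof -
  show "N v \<subseteq> {1..n}" using edge_subset by (fastforce simp: neighbours_def)
  then show "finite (N v)" using finite_subset by blast
qed

lemma neighbour_range: "u \<in> N v \<Longrightarrow> v \<in> {1..n}" "u \<in> N v \<Longrightarrow> u \<in> {1..n}"
  using neighbours_subset neighbours_commute by blast+

lemma card_neighbours: "v \<in> {1..n} \<Longrightarrow> card (N v) = 3"
  using cubic by (auto simp: cubic_graphs_def)

lemma card_neighbours_le: "card (N v) \<le> 3"
proof (cases "v \<in> {1..n}")
  case False
  then have "N v = {}" using neighbour_range by blast
  then show ?thesis by simp
qed (simp add: card_neighbours)

lemma neighbours_irrefl: "v \<notin> N v"
  using card_edge[of "{v}"] by (auto simp: neighbours_def)

lemma triangle_iff: "{a, b, c} \<in> triangles E \<longleftrightarrow> a \<in> N b \<and> b \<in> N c \<and> a \<in> N c"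
proof
  assume T: "{a, b, c} \<in> triangles E"
  then have "a \<noteq> b" "b \<noteq> c" "a \<noteq> c"
    by (auto simp: triangles_def insert_commute card_insert_if split: if_splits)
  with T show "a \<in> N b \<and> b \<in> N c \<and> a \<in> N c" by (auto simp: triangles_def neighbours_def)
next
  assume A: "a \<in> N b \<and> b \<in> N c \<and> a \<in> N c"
  then have "a \<noteq> b" "b \<noteq> c" "a \<noteq> c" using neighbours_irrefl by auto
  with A show "{a, b, c} \<in> triangles E"
    by (auto simp: triangles_def neighbours_def insert_commute)
qed

lemma triangle_subset: "T \<in> triangles E \<Longrightarrow> T \<subseteq> {1..n}"
proof
  fix x assume T: "T \<in> triangles E" "x \<in> T"
  then have "\<not> T \<subseteq> {x}" using card_mono[of "{x}" T] by (auto simp: triangles_def)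
  then obtain y where "y \<in> T" "y \<noteq> x" by auto
  with T have "{x, y} \<in> E" by (auto simp: triangles_def)
  then show "x \<in> {1..n}" using edge_subset by blast
qed

lemma finite_triangles [simp]: "finite (triangles E)"
  by (rule finite_subset[of _ "Pow {1..n}"]) (use triangle_subset in auto)

text \<open>The third vertex of a triangle on the edge is a common neighbour of its ends, and every
  common neighbour arises in this way.\<close>

lemma card_triangles_on:
  assumes "x \<in> N y"
  shows "card (triangles_on E {x, y}) = card (N x \<inter> N y)"
proof -
  have "bij_betw (\<lambda>p. {p, x, y}) (N x \<inter> N y) (triangles_on E {x, y})"
    unfolding bij_betw_def
  proof
    show "inj_on (\<lambda>p. {p, x, y}) (N x \<inter> N y)"
      using neighbours_irrefl by (intro inj_onI) blast
    show "(\<lambda>p. {p, x, y}) ` (N x \<inter> N y) = triangles_on E {x, y}"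
    proof (intro equalityI subsetI)
      fix T assume "T \<in> (\<lambda>p. {p, x, y}) ` (N x \<inter> N y)"
      then show "T \<in> triangles_on E {x, y}"
        using assms by (auto simp: triangles_on_def triangle_iff)
    next
      fix T assume T: "T \<in> triangles_on E {x, y}"
      have "x \<noteq> y" using assms neighbours_irrefl by auto
      then have "card (T - {x, y}) = 1"
        using T card_Diff_subset[of "{x, y}" T] by (auto simp: triangles_on_def triangles_def)
      then obtain p where "T - {x, y} = {p}" by (auto simp: card_1_singleton_iff)
      then have "T = {p, x, y}" using T by (auto simp: triangles_on_def)
      then show "T \<in> (\<lambda>p. {p, x, y}) ` (N x \<inter> N y)"
        using T by (auto simp: triangles_on_def triangle_iff)
    qed
  qed
  then show ?thesis by (rule bij_betw_same_card[symmetric])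
qed

lemma codegree_le:
  assumes "x \<in> N y"
  shows "card (N x \<inter> N y) \<le> 2"
proof -
  have "card (N x \<inter> N y) \<le> card (N y - {x})"
    using neighbours_irrefl by (intro card_mono) auto
  also have "\<dots> = card (N y) - 1" using assms by simp
  finally show ?thesis using card_neighbours_le[of y] by simp
qed

text \<open>Each of the four vertices exchanges one neighbour for a new one, so all degrees are
  preserved.\<close>

lemma switch_cubic:
  assumes "switchable E a b c d"
  shows "switch E a b c d \<in> cubic_graphs n"
proof -
  have N: "a \<in> N b" "b \<in> N a" "c \<in> N d" "d \<in> N c" "c \<notin> N a" "a \<notin> N c" "b \<notin> N d" "d \<notin> N b"
    and d: "a \<noteq> b" "a \<noteq> c" "a \<noteq> d" "b \<noteq> c" "b \<noteq> d" "c \<noteq> d"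
    using assms by (auto simp: switchable_def neighbours_def insert_commute)
  have r: "a \<in> {1..n}" "b \<in> {1..n}" "c \<in> {1..n}" "d \<in> {1..n}"
    using N(1-4) neighbour_range by blast+
  have "card (neighbours (switch E a b c d) v) = 3" if "v \<in> {1..n}" for v
    unfolding neighbours_switch[OF assms] using N r that by (simp add: card_neighbours)
  moreover have "e \<subseteq> {1..n} \<and> card e = 2" if "e \<in> switch E a b c d" for e
    using that edge_subset card_edge r d by (auto simp: switch_def)
  ultimately show ?thesis by (auto simp: cubic_graphs_def)
qed

lemma card_triangles_switch_ge:
  assumes "switchable E a b c d"
  shows "card (triangles E) \<le>
    card (triangles (switch E a b c d)) + card (N a \<inter> N b) + card (N c \<inter> N d)"
proof -
  interpret S: cubic_graph n "switch E a b c d"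
    by unfold_locales (rule switch_cubic[OF assms])
  have "card (triangles E) \<le> card (triangles (switch E a b c d) \<union> (triangles_on E {a, b} \<union> triangles_on E {c, d}))"
    using triangles_diff_subset_switch[of E a b c d]
    by (intro card_mono) (auto simp: triangles_on_def)
  also have "\<dots> \<le> card (triangles (switch E a b c d)) + (card (triangles_on E {a, b}) + card (triangles_on E {c, d}))"
    by (intro order.trans[OF card_Un_le] add_left_mono card_Un_le)
  finally show ?thesis
    using assms by (simp add: card_triangles_on switchable_def neighbours_def insert_commute)
qed

text \<open>The losses at the two removed edges add up exactly: a triangle containing both would
  have four distinct vertices.\<close>

lemma card_triangles_switch_le:
  assumes "switchable E a b c d"
  defines "E' \<equiv> switch E a b c d"
  shows "card (triangles E') + card (N a \<inter> N b) + card (N c \<inter> N d) \<le>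
    card (triangles E) + card (triangles_on E' {a, c}) + card (triangles_on E' {b, d})"
proof -
  interpret S: cubic_graph n E'
    unfolding E'_def by unfold_locales (rule switch_cubic[OF assms(1)])
  have fin: "finite (triangles_on E e)" "finite (triangles_on E' e)" for e
    by (auto simp: triangles_on_def)
  let ?L = "triangles_on E {a, b} \<union> triangles_on E {c, d}"
  have "triangles_on E {a, b} \<inter> triangles_on E {c, d} = {}"
  proof -
    have False if "T \<in> triangles E" "{a, b} \<subseteq> T" "{c, d} \<subseteq> T" for T
    proof -
      have "card {a, b, c, d} \<le> card T"
        using that by (intro card_mono) (auto simp: triangles_def intro: card_ge_0_finite)
      then show False using assms(1) that by (auto simp: switchable_def triangles_def)
    qed
    then show ?thesis by (auto simp: triangles_on_def)
  qed
  then have L: "card ?L = card (N a \<inter> N b) + card (N c \<inter> N d)"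
    using assms fin by (simp add: card_Un_disjoint card_triangles_on switchable_def neighbours_def insert_commute)
  have "card (triangles E') \<le> card ((triangles E - ?L) \<union> (triangles_on E' {a, c} \<union> triangles_on E' {b, d}))"
    using triangles_switch_subset[OF assms(1)] fin by (intro card_mono) (auto simp: E'_def)
  also have "\<dots> \<le> card (triangles E - ?L) + (card (triangles_on E' {a, c}) + card (triangles_on E' {b, d}))"
    by (intro order.trans[OF card_Un_le] add_left_mono card_Un_le)
  also have "card (triangles E - ?L) = card (triangles E) - card ?L"
    using fin by (intro card_Diff_subset) (auto simp: triangles_on_def)
  finally have "card (triangles E') \<le>
    card (triangles E) - card ?L + (card (triangles_on E' {a, c}) + card (triangles_on E' {b, d}))" .
  moreover have "card ?L \<le> card (triangles E)"
    by (intro card_mono) (auto simp: triangles_on_def)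
  ultimately show ?thesis using L by linarith
qed

text \<open>Two edges are removed and two are added, each in at most two triangles, so at most 4
  triangles are lost and at most 4 gained.\<close>

lemma switch_change_le:
  assumes "switchable E a b c d"
  shows "\<bar>real (card (triangles (switch E a b c d))) - real (card (triangles E))\<bar> \<le> 4"
proof -
  interpret S: cubic_graph n "switch E a b c d"
    by unfold_locales (rule switch_cubic[OF assms])
  have "a \<in> N b" "c \<in> N d" using assms by (auto simp: switchable_def neighbours_def)
  then have 1: "card (N a \<inter> N b) \<le> 2" "card (N c \<inter> N d) \<le> 2"
    by (auto intro: codegree_le)
  have "a \<in> S.N c" "b \<in> S.N d" by (auto simp: neighbours_def switch_def)
  then have "card (triangles_on (switch E a b c d) {a, c}) \<le> 2"
    "card (triangles_on (switch E a b c d) {b, d}) \<le> 2"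
    using S.card_triangles_on S.codegree_le by metis+
  with 1 card_triangles_switch_ge[OF assms] card_triangles_switch_le[OF assms] show ?thesis
    by linarith
qed

section \<open>Double counting of triangles and codegrees\<close>

lemma codegree_eq_card:
  "x \<in> N w \<Longrightarrow> N x \<inter> N w = {v \<in> {1..n}. (x, w) \<in> ordered_triangles_at E v}"
  using neighbour_range(2) neighbours_commute by (fastforce simp: ordered_triangles_at_def triangle_iff)

lemma ordered_triangles_at_subset: "ordered_triangles_at E v \<subseteq> oriented_edges E"
  by (auto simp: ordered_triangles_at_def triangle_iff oriented_edges_def neighbours_def)

lemma finite_oriented_edges [simp]: "finite (oriented_edges E)"
proof (rule finite_subset)
  show "oriented_edges E \<subseteq> {1..n} \<times> {1..n}" using edge_subset by (auto simp: oriented_edges_def)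
qed simp

lemma finite_ordered_triangles_at [simp]: "finite (ordered_triangles_at E v)"
  using ordered_triangles_at_subset finite_oriented_edges by (rule finite_subset)

lemma card_oriented_edges: "card (oriented_edges E) = 3 * n"
proof -
  have "oriented_edges E = prod.swap ` (SIGMA z:{1..n}. N z)"
    using neighbour_range by (auto simp: oriented_edges_def neighbours_def image_iff)
  then have "card (oriented_edges E) = card (SIGMA z:{1..n}. N z)"
    by (simp add: card_image)
  also have "\<dots> = 3 * n" by (simp add: card_neighbours)
  finally show ?thesis .
qed

lemma card_ordered_triangles_at:
  "card (ordered_triangles_at E v) = 2 * card (triangles_at E v)"
proof -
  have "ordered_triangles_at E v = (\<Union>T\<in>triangles_at E v. {(x, w). {v, x, w} = T})"
    by (auto simp: ordered_triangles_at_def triangles_at_def)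
  moreover have two: "finite {(x, w). {v, x, w} = T} \<and> card {(x, w). {v, x, w} = T} = 2"
    if "T \<in> triangles_at E v" for T
  proof -
    have "card (T - {v}) = 2" using that by (auto simp: triangles_at_def triangles_def)
    then obtain a b where ab: "T - {v} = {a, b}" "a \<noteq> b" by (auto simp: card_2_iff)
    then have "{(x, w). {v, x, w} = T} = {(a, b), (b, a)}"
      using that by (auto simp: triangles_at_def set_eq_iff)
    then show ?thesis using ab by simp
  qed
  moreover have "card (\<Union>T\<in>triangles_at E v. {(x, w). {v, x, w} = T}) =
      (\<Sum>T\<in>triangles_at E v. card {(x, w). {v, x, w} = T})"
    using two by (intro card_UN_disjoint) (auto simp: triangles_at_def)
  ultimately show ?thesis by simp
qed

lemma sum_card_triangles_at: "(\<Sum>v\<in>{1..n}. card (triangles_at E v)) = 3 * card (triangles E)"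
  unfolding triangles_at_def
proof (rule sum_multicount)
  show "\<forall>T\<in>triangles E. card {v \<in> {1..n}. v \<in> T} = 3"
  proof
    fix T assume T: "T \<in> triangles E"
    then have "{v \<in> {1..n}. v \<in> T} = T" using triangle_subset by blast
    with T show "card {v \<in> {1..n}. v \<in> T} = 3" by (simp add: triangles_def)
  qed
qed auto

text \<open>Both sides run over the pairs of an oriented edge \<open>(x, w)\<close> and an apex
  \<open>v\<close> that span a triangle. The weight \<open>f\<close> is later the constant 1 or the
  codegree itself.\<close>

lemma sum_codegree:
  "(\<Sum>(x, w)\<in>oriented_edges E. f x w * real (card (N x \<inter> N w))) =
    (\<Sum>v\<in>{1..n}. \<Sum>(x, w)\<in>ordered_triangles_at E v. f x w)"
proof -
  have "(\<Sum>v\<in>{1..n}. \<Sum>(x, w)\<in>ordered_triangles_at E v. f x w) =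
      (\<Sum>v\<in>{1..n}. \<Sum>p\<in>oriented_edges E. if p \<in> ordered_triangles_at E v then f (fst p) (snd p) else 0)"
    using ordered_triangles_at_subset
    by (intro sum.cong[OF refl]) (simp add: sum.If_cases case_prod_unfold Int_absorb1)
  also have "\<dots> = (\<Sum>p\<in>oriented_edges E. f (fst p) (snd p) * real (card (N (fst p) \<inter> N (snd p))))"
  proof (subst sum.swap, rule sum.cong[OF refl])
    fix p assume p: "p \<in> oriented_edges E"
    then have "N (fst p) \<inter> N (snd p) = {v \<in> {1..n}. p \<in> ordered_triangles_at E v}"
      using codegree_eq_card[of "fst p" "snd p"]
      by (simp add: oriented_edges_def neighbours_iff[of "fst p" E "snd p"] case_prod_unfold)
    then show "(\<Sum>v\<in>{1..n}. if p \<in> ordered_triangles_at E v then f (fst p) (snd p) else 0) =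
        f (fst p) (snd p) * real (card (N (fst p) \<inter> N (snd p)))"
      by (simp add: sum.If_cases Int_def)
  qed
  finally show ?thesis by (simp add: case_prod_unfold)
qed

text \<open>Each triangle is counted six times: three choices of the apex, two orientations of the
  opposite edge.\<close>

lemma sum_codegree_1: "(\<Sum>(x, w)\<in>oriented_edges E. real (card (N x \<inter> N w))) = 6 * real (card (triangles E))"
proof -
  have "(\<Sum>(x, w)\<in>oriented_edges E. real (card (N x \<inter> N w))) =
      (\<Sum>v\<in>{1..n}. real (card (ordered_triangles_at E v)))"
    using sum_codegree[of "\<lambda>_ _. 1"] by (simp add: case_prod_unfold)
  also have "\<dots> = 2 * real (\<Sum>v\<in>{1..n}. card (triangles_at E v))"
    by (simp add: card_ordered_triangles_at sum_distrib_left)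
  finally show ?thesis by (simp only: sum_card_triangles_at)
qed

lemma triangles_at_eq_edges:
  "(\<lambda>T. T - {v}) ` triangles_at E v \<subseteq> {e. e \<subseteq> N v \<and> card e = 2}"
  by (auto simp: triangles_at_def triangles_def neighbours_def insert_commute)

text \<open>A triangle at \<open>v\<close> is determined by its opposite edge, which is a pair of
  neighbours of \<open>v\<close>.\<close>

lemma card_triangles_at_le: "card (triangles_at E v) \<le> 3"
proof -
  have "inj_on (\<lambda>T. T - {v}) (triangles_at E v)"
    by (intro inj_onI) (auto simp: triangles_at_def)
  then have "card (triangles_at E v) = card ((\<lambda>T. T - {v}) ` triangles_at E v)"
    by (simp add: card_image)
  also have "\<dots> \<le> card {e. e \<subseteq> N v \<and> card e = 2}"
    using triangles_at_eq_edges by (intro card_mono) auto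
  also have "\<dots> = card (N v) choose 2" by (simp add: n_subsets)
  also have "\<dots> \<le> 3"
  proof -
    consider "card (N v) = 0" | "card (N v) = 1" | "card (N v) = 2" | "card (N v) = 3"
      using card_neighbours_le[of v] by linarith
    then show ?thesis by cases (simp_all add: choose_two)
  qed
  finally show ?thesis .
qed

section \<open>Existence of a make move\<close>

lemma exists_nonadjacent:
  assumes v: "v \<in> {1..n}" and less: "card (triangles_at E v) < 3"
  obtains x w u where "N v = {x, w, u}" "x \<noteq> w" "w \<noteq> u" "x \<noteq> u" "x \<notin> N w"
proof -
  obtain a b c where abc: "N v = {a, b, c}" "a \<noteq> b" "b \<noteq> c" "a \<noteq> c"
    using card_neighbours[OF v] by (auto simp: card_3_iff)
  have "\<not> (a \<in> N b \<and> b \<in> N c \<and> a \<in> N c)"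
  proof
    assume adj: "a \<in> N b \<and> b \<in> N c \<and> a \<in> N c"
    have "v \<in> N a" "v \<in> N b" "v \<in> N c"
      using abc(1) by (simp_all add: neighbours_commute[of v])
    then have "{{v, a, b}, {v, b, c}, {v, a, c}} \<subseteq> triangles_at E v"
      using adj by (simp add: triangles_at_def triangle_iff)
    moreover have "card {{v, a, b}, {v, b, c}, {v, a, c}} = 3"
    proof -
      have "v \<noteq> a" "v \<noteq> b" "v \<noteq> c" using abc neighbours_irrefl[of v] by auto
      then have "a \<notin> {v, b, c}" "b \<notin> {v, a, c}" using abc by simp_all
      moreover have "a \<in> {v, a, b}" "b \<in> {v, a, b}" "b \<in> {v, b, c}" by simp_all
      ultimately have "{v, a, b} \<noteq> {v, b, c}" "{v, a, b} \<noteq> {v, a, c}" "{v, b, c} \<noteq> {v, a, c}"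
        by metis+
      then show ?thesis by (simp only: card_insert_if finite.intros insert_iff empty_iff) simp
    qed
    moreover have "finite (triangles_at E v)" by (simp add: triangles_at_def)
    ultimately have "3 \<le> card (triangles_at E v)" by (metis card_mono)
    with less show False by simp
  qed
  then consider "a \<notin> N b" | "b \<notin> N c" | "a \<notin> N c" by blast
  then show thesis
  proof cases
    case 1 then show ?thesis using that[of a b c] abc by auto
  next
    case 2 then show ?thesis using that[of b c a] abc by auto
  next
    case 3 then show ?thesis using that[of a c b] abc by auto
  qed
qed

lemma other_neighbours:
  assumes "v \<in> N x"
  obtains a b where "N x = {v, a, b}" "a \<noteq> b" "a \<noteq> v" "b \<noteq> v"
proof -
  have "card (N x - {v}) = 2"
    using assms card_neighbours[of x] neighbour_range[OF assms] by simp
  then obtain a b where "N x - {v} = {a, b}" "a \<noteq> b" by (auto simp: card_2_iff)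
  then show ?thesis using assms by (intro that[of a b]) auto
qed

text \<open>If the pair \<open>x, w\<close> admits no choice of \<open>y, z\<close>, then the neighbourhoods of \<open>x\<close> and \<open>w\<close> span a
  saturated piece of the graph, and the third neighbour \<open>u\<close> of \<open>v\<close> lies outside it.\<close>

lemma path_pairs_nonempty:
  assumes v: "v \<in> {1..n}" and less: "card (triangles_at E v) < 3"
  shows "path_pairs E v \<noteq> {}"
proof
  assume empty: "path_pairs E v = {}"
  \<comment> \<open>Emptiness means that each nonadjacent pair of neighbours of \<open>v\<close>
    blocks every choice of \<open>y\<close> and \<open>z\<close>.\<close>
  have bad: "y = z \<or> y \<in> N z"
    if "x \<in> N v" "w \<in> N v" "x \<noteq> w" "w \<notin> N x" "y \<in> N x - {v}" "z \<in> N w - {v}" for x w y z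
  proof (rule ccontr)
    assume "\<not> (y = z \<or> y \<in> N z)"
    then have "{(v, x, y), (v, w, z)} \<in> path_pairs E v"
      using that unfolding path_pairs_def neighbours_iff by blast
    with empty show False by simp
  qed
  obtain x w u where xwu: "N v = {x, w, u}" "x \<noteq> w" "w \<noteq> u" "x \<noteq> u" "x \<notin> N w"
    by (rule exists_nonadjacent[OF v less])
  have "v \<in> N x" "v \<in> N w" "v \<in> N u"
    using xwu(1) by (simp_all add: neighbours_commute[of v])
  obtain a b where ab: "N x = {v, a, b}" "a \<noteq> b" "a \<noteq> v" "b \<noteq> v" by (rule other_neighbours[OF \<open>v \<in> N x\<close>])
  obtain c d where cd: "N w = {v, c, d}" "c \<noteq> d" "c \<noteq> v" "d \<noteq> v" by (rule other_neighbours[OF \<open>v \<in> N w\<close>])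
  obtain e f where ef: "N u = {v, e, f}" "e \<noteq> f" "e \<noteq> v" "f \<noteq> v" by (rule other_neighbours[OF \<open>v \<in> N u\<close>])
  have sym: "p \<in> N q \<longleftrightarrow> q \<in> N p" for p q by (rule neighbours_commute)
  have irr: "p \<notin> N p" for p by (rule neighbours_irrefl)
  have deg: "N p = {q1, q2, q3}" if "{q1, q2, q3} \<subseteq> N p" "q1 \<noteq> q2" "q2 \<noteq> q3" "q1 \<noteq> q3" for p q1 q2 q3
    by (rule card_seteq[symmetric]) (use that card_neighbours_le[of p] in auto)
  have xw: "x \<notin> N w" "w \<notin> N x" using xwu(5) sym[of x w] by simp_all
  have 1: "p = q \<or> p \<in> N q" if "p \<in> {a, b}" "q \<in> {c, d}" for p q
    by (rule bad[of x w]) (use xwu xw ab cd that in auto)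
  have nb: "x \<in> N a" "x \<in> N b" "w \<in> N c" "w \<in> N d"
    using ab(1) cd(1) by (simp_all add: sym[of x] sym[of w])
  have deg4: False if "distinct [q1, q2, q3, q4]" "{q1, q2, q3, q4} \<subseteq> N p" for p q1 q2 q3 q4
    using that card_mono[OF finite_neighbours[of p] that(2)] card_neighbours_le[of p] by simp
  have ne: "x \<noteq> a" "x \<noteq> b" "x \<noteq> c" "x \<noteq> d" "w \<noteq> a" "w \<noteq> b" "w \<noteq> c" "w \<noteq> d" "v \<noteq> x" "v \<noteq> w" "v \<noteq> u"
    using xw irr[of x] irr[of w] irr[of v] ab(1) cd(1) xwu(1) by auto
  \<comment> \<open>This puts \<open>a\<close> at distance more than 2 from \<open>u\<close>, so
    \<open>a\<close> neither equals nor is adjacent to the neighbour \<open>e\<close> of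
    \<open>u\<close>, against \<open>bad\<close> for the pair \<open>x, u\<close>.\<close>
  have key: "u \<notin> N a \<and> (\<forall>p\<in>N a. u \<notin> N p) \<and> u \<notin> N x"
  proof (cases "{a, b} \<inter> {c, d} = {}")
    case True
    \<comment> \<open>Here \<open>a, b\<close> and \<open>c, d\<close> are joined completely;
      together with \<open>x\<close> or \<open>w\<close> this exhausts the degree 3 of all four
      vertices.\<close>
    have q: "a \<in> N c" "a \<in> N d" "b \<in> N c" "b \<in> N d"
      using 1[of a c] 1[of a d] 1[of b c] 1[of b d] True by simp_all
    then have q': "c \<in> N a" "d \<in> N a" "c \<in> N b" "d \<in> N b"
      by (simp_all add: sym[of c] sym[of d])
    have N: "N a = {x, c, d}" "N b = {x, c, d}" "N c = {w, a, b}" "N d = {w, a, b}"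
      by (rule deg; use nb q q' ne ab(2) cd(2) in simp)+
    have "v \<notin> N a" "v \<notin> N b" "v \<notin> N c" "v \<notin> N d" using N ne ab cd by auto
    then have "u \<noteq> a" "u \<noteq> b" "u \<noteq> c" "u \<noteq> d" using \<open>v \<in> N u\<close> by auto
    then show ?thesis using N ab(1) ne xwu by simp
  next
    case False
    \<comment> \<open>Here a common neighbour \<open>p\<close> of \<open>x\<close> and
      \<open>w\<close> is adjacent to \<open>x\<close>, \<open>w\<close>, \<open>q\<close> and
      \<open>p'\<close>. Degree 3 forces \<open>q = p'\<close>, so \<open>x\<close> and
      \<open>w\<close> have the same neighbours.\<close>
    have "\<exists>c' d'. {c', d'} = {c, d} \<and> (c' = a \<or> c' = b) \<and> c' \<noteq> d'"
      using False cd(2) by auto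
    then obtain p p' q where pq: "{p, p'} = {a, b}" "{p, q} = {c, d}" "p \<noteq> p'" "p \<noteq> q"
      using ab(2) by (metis insert_commute)
    have n: "x \<in> N p" "w \<in> N p" using nb pq by auto
    have 2: "p \<in> N q" "p' \<in> N p" using 1[of p q] 1[of p' p] pq by auto
    have "q = p'"
    proof (rule ccontr)
      assume "q \<noteq> p'"
      then show False
        using deg4[of x w q p' p] n 2 sym[of q p] pq ne xwu(2) by (auto simp: doubleton_eq_iff)
    qed
    then have "{c, d} = {a, b}" "a \<in> N b" using pq 2 sym[of a b] by (auto simp: doubleton_eq_iff)
    then have q: "w \<in> N a" "w \<in> N b" "b \<in> N a"
      using nb sym[of a b] by (auto simp: doubleton_eq_iff)
    have N: "N a = {x, w, b}" "N b = {x, w, a}"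
      by (rule deg; use nb q \<open>a \<in> N b\<close> ne xwu(2) in simp)+
    have "v \<notin> N a" "v \<notin> N b" using N ne ab by auto
    then have u: "u \<noteq> a" "u \<noteq> b" using \<open>v \<in> N u\<close> by auto
    have "N w = {v, a, b}" using cd(1) \<open>{c, d} = {a, b}\<close> by simp
    then show ?thesis using N u ab(1) ne xwu by simp
  qed
  have "e \<in> N u" using ef by simp
  then have ue: "u \<in> N e" using sym[of e u] by simp
  have "a = e \<or> a \<in> N e"
    by (rule bad[of x u]) (use xwu key ab ef in auto)
  then show False using key ue sym[of a e] by auto
qed

end


section \<open>The drift of the number of triangles\<close>

context cubic_graph
begin

section \<open>Outcomes and expectations of one step\<close>

abbreviation "num_tri \<equiv> real (card (triangles E))"
abbreviation "tri_at v \<equiv> real (card (triangles_at E v))"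

lemma bernoulli_pmf_0: "bernoulli_pmf 0 = return_pmf False"
  and bernoulli_pmf_1: "bernoulli_pmf 1 = return_pmf True"
proof -
  have "pmf (bernoulli_pmf 0) i = pmf (return_pmf False) i" for i by (cases i) simp_all
  then show "bernoulli_pmf 0 = return_pmf False" by (intro pmf_eqI)
  have "pmf (bernoulli_pmf 1) i = pmf (return_pmf True) i" for i by (cases i) simp_all
  then show "bernoulli_pmf 1 = return_pmf True" by (intro pmf_eqI)
qed

definition step_at :: "nat \<Rightarrow> graph pmf" where
  "step_at v = do {
     b \<leftarrow> bernoulli_pmf (tri_at v / 3);
     if b then break_step E v else make_step E v
   }"

lemma sum_tri_at: "(\<Sum>v\<in>{1..n}. tri_at v) = 3 * num_tri"
  using sum_card_triangles_at by (simp flip: of_nat_sum)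

lemma finite_path_pairs: "finite (path_pairs E v)"
proof (rule finite_subset)
  let ?A = "{1..n} \<times> {1..n} \<times> {1..n}"
  show "path_pairs E v \<subseteq> Pow ?A"
    using neighbour_range unfolding path_pairs_def by (auto simp del: atLeastAtMost_iff)
qed simp

lemma path_pairsE:
  assumes "q \<in> path_pairs E v"
  obtains x y w z where "switchable E x y w z" "make_pair E q = switch E x y w z"
    "x \<in> N v" "w \<in> N v" "x \<notin> N w" "y \<in> N x" "z \<in> N w" "y \<noteq> v" "z \<noteq> v" "x \<noteq> w"
proof -
  obtain x y w z where q: "q = {(v, x, y), (v, w, z)}" "x \<in> N v" "w \<in> N v" "x \<noteq> w" "{w, x} \<notin> E"
      "y \<in> N x" "y \<noteq> v" "z \<in> N w" "z \<noteq> v" "y \<noteq> z" "{y, z} \<notin> E"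
    using assms unfolding path_pairs_def by blast
  have "switchable E x y w z"
    using q neighbours_irrefl[of x] neighbours_irrefl[of w]
    by (auto simp: switchable_def neighbours_iff insert_commute)
  moreover have "make_pair E q = switch E x y w z"
    by (simp add: q(1) make_pair_eq make_eq_switch)
  ultimately show ?thesis
    using q by (intro that[of x y w z]) (auto simp: neighbours_iff insert_commute)
qed

lemma break_switchable:
  assumes "(x, w) \<in> ordered_triangles_at E v" "(y, z) \<in> oriented_edges E" "break_allowed E v x w y z"
  shows "switchable E x w y z"
proof -
  have "x \<in> N w" "y \<in> N z"
    using assms by (simp_all add: ordered_triangles_at_def triangle_iff oriented_edges_def neighbours_iff)
  then show ?thesis
    using assms(3) neighbours_irrefl by (auto simp: switchable_def break_allowed_def neighbours_iff)
qed

lemma set_pmf_break_step: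
  assumes "0 < card (triangles_at E v)" "0 < n" "E' \<in> set_pmf (break_step E v)"
  shows "E' = E \<or> (\<exists>a b c d. switchable E a b c d \<and> E' = switch E a b c d)"
proof -
  have "ordered_triangles_at E v \<noteq> {}" "oriented_edges E \<noteq> {}"
    using assms card_ordered_triangles_at[of v] card_oriented_edges by auto
  note ne = set_pmf_of_set[OF this(1) finite_ordered_triangles_at] set_pmf_of_set[OF this(2) finite_oriented_edges]
  show ?thesis
    using assms(3) break_switchable
    unfolding break_step_def set_bind_pmf
    by (fastforce simp: ne break_eq_switch split: if_splits)
qed

lemma finite_set_pmf_break_step:
  assumes "0 < card (triangles_at E v)" "0 < n"
  shows "finite (set_pmf (break_step E v))"
proof -
  have "ordered_triangles_at E v \<noteq> {}" "oriented_edges E \<noteq> {}"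
    using assms card_ordered_triangles_at[of v] card_oriented_edges by auto
  note ne = set_pmf_of_set[OF this(1) finite_ordered_triangles_at] set_pmf_of_set[OF this(2) finite_oriented_edges]
  show ?thesis
    unfolding break_step_def set_bind_pmf
    by (simp add: ne case_prod_unfold)
qed

lemma finite_set_pmf_make_step:
  assumes "v \<in> {1..n}" "card (triangles_at E v) < 3"
  shows "finite (set_pmf (make_step E v))"
  using path_pairs_nonempty[OF assms] finite_path_pairs by (simp add: make_step_def set_pmf_of_set)

lemma set_pmf_make_step:
  assumes "v \<in> {1..n}" "card (triangles_at E v) < 3"
  shows "set_pmf (make_step E v) = make_pair E ` path_pairs E v"
  using path_pairs_nonempty[OF assms] finite_path_pairs by (simp add: make_step_def set_pmf_of_set)

text \<open>In the extreme cases the coin is deterministic, and the branch that may lack a nonempty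
  set to choose from drops out.\<close>

lemma step_at_cases:
  assumes v: "v \<in> {1..n}"
  obtains (make) "card (triangles_at E v) = 0" "step_at v = make_step E v"
    | (break) "card (triangles_at E v) = 3" "step_at v = break_step E v"
    | (mixed) "0 < card (triangles_at E v)" "card (triangles_at E v) < 3"
proof -
  consider "card (triangles_at E v) = 0" | "card (triangles_at E v) = 3"
    | "0 < card (triangles_at E v)" "card (triangles_at E v) < 3"
    using card_triangles_at_le[of v] by linarith
  then show thesis
  proof cases
    case 1
    then have "step_at v = make_step E v" by (simp add: step_at_def bernoulli_pmf_0 bind_return_pmf)
    with 1 show ?thesis by (rule make)
  next
    case 2
    then have "step_at v = break_step E v" by (simp add: step_at_def bernoulli_pmf_1 bind_return_pmf)
    with 2 show ?thesis by (rule break)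
  qed (rule mixed)
qed

lemma set_pmf_step_at:
  assumes v: "v \<in> {1..n}" and E': "E' \<in> set_pmf (step_at v)"
  shows "E' = E \<or> (\<exists>a b c d. switchable E a b c d \<and> E' = switch E a b c d)"
proof -
  have n: "0 < n" using v by simp
  have mk: "E' = E \<or> (\<exists>a b c d. switchable E a b c d \<and> E' = switch E a b c d)"
    if m: "E' \<in> set_pmf (make_step E v)" "card (triangles_at E v) < 3"
  proof -
    obtain q where q: "q \<in> path_pairs E v" "E' = make_pair E q"
      using m(1) unfolding set_pmf_make_step[OF v m(2)] by blast
    from q(1) obtain x y w z where "switchable E x y w z" "make_pair E q = switch E x y w z"
      by (rule path_pairsE)
    with q(2) show ?thesis by blast
  qed
  from v show ?thesis
  proof (cases rule: step_at_cases)
    case mixed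
    then have "E' \<in> set_pmf (break_step E v) \<or> E' \<in> set_pmf (make_step E v)"
      using E' by (auto simp: step_at_def split: if_splits)
    then show ?thesis using mk set_pmf_break_step[OF mixed(1) n] mixed(2) by blast
  next
    case make
    then show ?thesis using mk E' by simp
  next
    case break
    then show ?thesis using set_pmf_break_step[OF _ n, of v E'] E' by simp
  qed
qed

lemma finite_set_pmf_step_at:
  assumes v: "v \<in> {1..n}"
  shows "finite (set_pmf (step_at v))"
proof (rule finite_subset)
  show "set_pmf (step_at v) \<subseteq> Pow (Pow {1..n})"
  proof
    fix E' assume "E' \<in> set_pmf (step_at v)"
    then have "E' \<in> cubic_graphs n" using set_pmf_step_at[OF v] cubic switch_cubic by blast
    then show "E' \<in> Pow (Pow {1..n})" by (auto simp: cubic_graphs_def)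
  qed
qed simp

text \<open>In the extreme cases the coefficient of the excluded branch is 0, so the formula holds
  whatever the expectation of that branch may be.\<close>

lemma expectation_step_at:
  fixes f :: "graph \<Rightarrow> real"
  assumes v: "v \<in> {1..n}"
  shows "measure_pmf.expectation (step_at v) f =
    tri_at v / 3 * measure_pmf.expectation (break_step E v) f +
    (1 - tri_at v / 3) * measure_pmf.expectation (make_step E v) f"
  using v
proof (cases rule: step_at_cases)
  case mixed
  have fin: "finite (set_pmf (if b then break_step E v else make_step E v))" for b
    using mixed v by (auto intro: finite_set_pmf_break_step finite_set_pmf_make_step)
  show ?thesis
    unfolding step_at_def using mixed(2)
    by (subst pmf_expectation_bind[where A = UNIV]) (use fin in \<open>auto simp: UNIV_bool\<close>)
qed auto

lemma expectation_chainII_step: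
  fixes f :: "graph \<Rightarrow> real"
  assumes "0 < n"
  shows "measure_pmf.expectation (chainII_step n E) f =
    (\<Sum>v\<in>{1..n}. measure_pmf.expectation (step_at v) f) / real n"
proof -
  have "chainII_step n E = pmf_of_set {1..n} \<bind> step_at"
    by (simp add: chainII_step_def step_at_def[abs_def])
  then show ?thesis
    using assms finite_set_pmf_step_at
    by (simp only:, subst pmf_expectation_bind_pmf_of_set)
      (simp_all add: divide_inverse_commute sum_distrib_left del: atLeastAtMost_iff)
qed

lemma set_pmf_chainII_step:
  assumes "0 < n" "E' \<in> set_pmf (chainII_step n E)"
  shows "E' = E \<or> (\<exists>a b c d. switchable E a b c d \<and> E' = switch E a b c d)"
proof -
  have "chainII_step n E = pmf_of_set {1..n} \<bind> step_at"
    by (simp add: chainII_step_def step_at_def[abs_def])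
  then obtain v where "v \<in> {1..n}" "E' \<in> set_pmf (step_at v)"
    using assms by (auto simp: set_pmf_of_set)
  then show ?thesis by (rule set_pmf_step_at)
qed

lemma step_jump:
  assumes "E' = E \<or> (\<exists>a b c d. switchable E a b c d \<and> E' = switch E a b c d)"
  shows "\<bar>real (card (triangles E')) - num_tri\<bar> \<le> 4"
  using assms switch_change_le by auto

lemma expectation_le:
  fixes f :: "'b \<Rightarrow> real"
  assumes "finite (set_pmf p)" "\<And>x. x \<in> set_pmf p \<Longrightarrow> f x \<le> b"
  shows "measure_pmf.expectation p f \<le> b"
proof -
  have "measure_pmf.expectation p f \<le> measure_pmf.expectation p (\<lambda>_. b)"
    using assms by (intro integral_mono_AE) (auto simp: AE_measure_pmf_iff integrable_measure_pmf_finite)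
  then show ?thesis by simp
qed

lemma expectation_ge:
  fixes f :: "'b \<Rightarrow> real"
  assumes "finite (set_pmf p)" "\<And>x. x \<in> set_pmf p \<Longrightarrow> b \<le> f x"
  shows "b \<le> measure_pmf.expectation p f"
  using expectation_le[of p "\<lambda>x. - f x" "- b"] assms by simp

section \<open>Drift bound for few triangles\<close>

abbreviation "change E' \<equiv> real (card (triangles E')) - num_tri"

text \<open>The move creates the triangle \<open>vxw\<close>. Each triangle it destroys contains
  \<open>xy\<close> or \<open>wz\<close>, hence one of the vertices \<open>x\<close>,
  \<open>w\<close> of \<open>N v\<close>.\<close>

lemma make_change_ge:
  assumes "q \<in> path_pairs E v"
  shows "1 - real (card {T \<in> triangles E. N v \<inter> T \<noteq> {}}) \<le> change (make_pair E q)"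
proof -
  obtain x y w z where s: "switchable E x y w z" "make_pair E q = switch E x y w z"
    and q: "x \<in> N v" "w \<in> N v" "x \<notin> N w" "y \<in> N x" "z \<in> N w" "y \<noteq> v" "z \<noteq> v" "x \<noteq> w"
    by (rule path_pairsE[OF assms])
  let ?E' = "switch E x y w z"
  interpret S: cubic_graph n ?E' by unfold_locales (rule switch_cubic[OF s(1)])
  let ?L = "{T \<in> triangles E. N v \<inter> T \<noteq> {}}"
  have "v \<in> N x" "v \<in> N w" using q by (simp_all add: neighbours_commute[of v])
  have "{v, x, w} \<in> triangles ?E'"
  proof -
    have "x \<in> S.N w" by (simp add: neighbours_def switch_def)
    moreover have "v \<in> S.N x" "v \<in> S.N w"
      using q \<open>v \<in> N x\<close> \<open>v \<in> N w\<close> neighbours_irrefl[of v] s(1)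
      by (simp_all add: neighbours_switch[OF s(1)] switchable_def)
    ultimately show ?thesis by (simp add: S.triangle_iff)
  qed
  moreover have "{v, x, w} \<notin> triangles E" using q by (simp add: triangle_iff)
  moreover have "triangles_on E {x, y} \<union> triangles_on E {w, z} \<subseteq> ?L"
    using q by (auto simp: triangles_on_def)
  ultimately have "insert {v, x, w} (triangles E - ?L) \<subseteq> triangles ?E'"
    using triangles_diff_subset_switch[of E x y w z] by blast
  then have "card (insert {v, x, w} (triangles E - ?L)) \<le> card (triangles ?E')"
    by (intro card_mono) auto
  moreover have "card (insert {v, x, w} (triangles E - ?L)) = Suc (card (triangles E - ?L))"
    using \<open>{v, x, w} \<notin> triangles E\<close> by simp
  moreover have "card (triangles E - ?L) = card (triangles E) - card ?L"
    by (intro card_Diff_subset) auto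
  moreover have "card ?L \<le> card (triangles E)" by (intro card_mono) auto
  ultimately show ?thesis using s(2) by simp
qed

text \<open>A triangle can only be lost by a make move at one of its own vertices, where a make move has
  probability at most \<open>2/3\<close>, or at one of the at most three vertices adjacent to it.\<close>

lemma sum_lost_le:
  "(\<Sum>v\<in>{1..n}. (1 - tri_at v / 3) * real (card {T \<in> triangles E. N v \<inter> T \<noteq> {}})) \<le> 5 * num_tri"
proof -
  let ?w = "\<lambda>v. 1 - tri_at v / 3"
  have w: "0 \<le> ?w v" "?w v \<le> 1" for v using card_triangles_at_le[of v] by simp_all
  have "(\<Sum>v\<in>{1..n}. ?w v * real (card {T \<in> triangles E. N v \<inter> T \<noteq> {}})) =
      (\<Sum>v\<in>{1..n}. \<Sum>T\<in>triangles E. if N v \<inter> T \<noteq> {} then ?w v else 0)"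
    by (intro sum.cong refl) (simp add: sum.If_cases Int_def mult.commute)
  also have "\<dots> = (\<Sum>T\<in>triangles E. \<Sum>v\<in>{1..n}. if N v \<inter> T \<noteq> {} then ?w v else 0)"
    by (rule sum.swap)
  also have "\<dots> \<le> (\<Sum>T\<in>triangles E. 5)"
  proof (rule sum_mono)
    fix T assume T: "T \<in> triangles E"
    \<comment> \<open>The outside neighbours of \<open>T\<close>. Each vertex of \<open>T\<close>
      has two neighbours inside, so there are at most 3 outside; the total weight is at most
      \<open>3 * (2 / 3) + 3 * 1 = 5\<close>.\<close>
    define O' where "O' = (\<Union>x\<in>T. N x - T)"
    have cT: "card T = 3" "finite T" using T by (auto simp: triangles_def intro: card_ge_0_finite)
    have "card O' \<le> (\<Sum>x\<in>T. card (N x - T))"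
      unfolding O'_def by (rule card_UN_le) (rule cT)
    also have "\<dots> \<le> (\<Sum>x\<in>T. 1)"
    proof (rule sum_mono)
      fix x assume x: "x \<in> T"
      have "T - {x} \<subseteq> N x"
        using T x by (intro subsetI) (simp add: triangles_def neighbours_iff)
      then have "card (N x - (T - {x})) \<le> 1"
        using card_neighbours_le[of x] cT x by (subst card_Diff_subset) auto
      moreover have "N x - T = N x - (T - {x})" using neighbours_irrefl[of x] by auto
      ultimately show "card (N x - T) \<le> 1" by simp
    qed
    finally have cO: "card O' \<le> 3" using cT by simp
    have fO: "finite O'" using cT by (auto simp: O'_def)
    have "(\<Sum>v\<in>{1..n}. if N v \<inter> T \<noteq> {} then ?w v else 0) = (\<Sum>v\<in>{v\<in>{1..n}. N v \<inter> T \<noteq> {}}. ?w v)"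
      by (simp add: sum.If_cases Int_def)
    also have "\<dots> \<le> (\<Sum>v\<in>T \<union> O'. ?w v)"
    proof (rule sum_mono2)
      show "{v\<in>{1..n}. N v \<inter> T \<noteq> {}} \<subseteq> T \<union> O'"
        using neighbours_commute unfolding O'_def by blast
    qed (use cT fO w in auto)
    also have "\<dots> = (\<Sum>v\<in>T. ?w v) + (\<Sum>v\<in>O'. ?w v)"
      using cT fO by (intro sum.union_disjoint) (auto simp: O'_def)
    also have "\<dots> \<le> (\<Sum>v\<in>T. 2 / 3) + (\<Sum>v\<in>O'. 1)"
    proof (intro add_mono sum_mono)
      fix v assume "v \<in> T"
      then have "triangles_at E v \<noteq> {}" using T by (auto simp: triangles_at_def)
      then have "card (triangles_at E v) \<noteq> 0" by (simp add: triangles_at_def)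
      then show "?w v \<le> 2 / 3" by simp
    qed (rule w)
    also have "\<dots> \<le> 5" using cT cO by simp
    finally show "(\<Sum>v\<in>{1..n}. if N v \<inter> T \<noteq> {} then ?w v else 0) \<le> 5" .
  qed
  finally show ?thesis by simp
qed

text \<open>The break branch enters through its worst case \<open>- 4\<close>. As
  \<open>tri_at v\<close> sums to \<open>3 * num_tri\<close>, the terms
  \<open>1 - 5 / 3 * tri_at v\<close> sum to \<open>n - 5 * num_tri\<close>; triangles lost in make
  moves cost at most another \<open>5 * num_tri\<close>.\<close>

lemma drift_ge:
  assumes n: "0 < n"
  shows "1 - 10 * (num_tri / real n) \<le> measure_pmf.expectation (chainII_step n E) change"
proof -
  define L where "L v = real (card {T \<in> triangles E. N v \<inter> T \<noteq> {}})" for v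
  have v: "tri_at v / 3 * (- 4) + (1 - tri_at v / 3) * (1 - L v) \<le>
      measure_pmf.expectation (step_at v) change" if v: "v \<in> {1..n}" for v
  proof -
    have "tri_at v / 3 * (- 4) \<le> tri_at v / 3 * measure_pmf.expectation (break_step E v) change"
    proof (cases "card (triangles_at E v) = 0")
      case False
      then have "- 4 \<le> measure_pmf.expectation (break_step E v) change"
        using n by (intro expectation_ge finite_set_pmf_break_step)
          (auto dest!: set_pmf_break_step[rotated 2] step_jump)
      then show ?thesis by (intro mult_left_mono) auto
    qed simp
    moreover have "(1 - tri_at v / 3) * (1 - L v) \<le>
        (1 - tri_at v / 3) * measure_pmf.expectation (make_step E v) change"
    proof (cases "card (triangles_at E v) < 3")
      case True
      then have "1 - L v \<le> measure_pmf.expectation (make_step E v) change"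
        using v make_change_ge by (intro expectation_ge finite_set_pmf_make_step)
          (auto simp: set_pmf_make_step L_def)
      then show ?thesis using True by (intro mult_left_mono) auto
    next
      case False
      then have "tri_at v = 3" using card_triangles_at_le[of v] by simp
      then show ?thesis by simp
    qed
    ultimately show ?thesis unfolding expectation_step_at[OF v] by (rule add_mono)
  qed
  have "(\<Sum>v\<in>{1..n}. 5 / 3 * tri_at v) = 5 * num_tri"
    unfolding sum_distrib_left[symmetric] sum_tri_at by simp
  then have "real n - 10 * num_tri \<le>
      (\<Sum>v\<in>{1..n}. 1 - 5 / 3 * tri_at v - (1 - tri_at v / 3) * L v)"
    using sum_lost_le by (simp add: sum_subtractf L_def)
  also have "\<dots> = (\<Sum>v\<in>{1..n}. tri_at v / 3 * (- 4) + (1 - tri_at v / 3) * (1 - L v))"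
    by (intro sum.cong[OF refl]) (simp add: field_simps)
  also have "\<dots> \<le> (\<Sum>v\<in>{1..n}. measure_pmf.expectation (step_at v) change)"
    by (rule sum_mono) (rule v)
  finally have "(real n - 10 * num_tri) / real n \<le>
      (\<Sum>v\<in>{1..n}. measure_pmf.expectation (step_at v) change) / real n"
    using n by (intro divide_right_mono) auto
  then show ?thesis
    using n by (simp add: expectation_chainII_step diff_divide_distrib)
qed

section \<open>Drift bound for many triangles\<close>

definition codeg :: "nat \<Rightarrow> nat \<Rightarrow> real" where
  "codeg x y = real (card (N x \<inter> N y))"

lemma codeg_le: "x \<in> N y \<Longrightarrow> codeg x y \<le> 2"
  using codegree_le[of x y] by (simp add: codeg_def)

text \<open>The ball of radius 2 around \<open>x\<close>: a vertex outside it is not adjacent to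
  \<open>x\<close> and shares no neighbour with it.\<close>

definition near :: "nat \<Rightarrow> nat set" where
  "near x = insert x (N x \<union> (\<Union>p\<in>N x. N p))"

lemma finite_near [simp]: "finite (near x)"
  by (simp add: near_def)

text \<open>\<open>13 = 1 + 3 + 9\<close>: the centre, its neighbours, and theirs.\<close>

lemma card_near_le: "card (near x) \<le> 13"
proof -
  have "card (\<Union>p\<in>N x. N p) \<le> (\<Sum>p\<in>N x. card (N p))" by (rule card_UN_le) simp
  also have "\<dots> \<le> (\<Sum>p\<in>N x. 3)" by (intro sum_mono card_neighbours_le)
  also have "\<dots> \<le> 9" using card_neighbours_le[of x] by simp
  finally have "card (N x \<union> (\<Union>p\<in>N x. N p)) \<le> 3 + 9"
    by (intro order.trans[OF card_Un_le] add_mono card_neighbours_le)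
  then show ?thesis by (simp add: near_def card_insert_if)
qed

lemma card_oriented_edges_from_le:
  assumes "finite B"
  shows "card {(y, z) \<in> oriented_edges E. y \<in> B} \<le> 3 * card B"
    and "card {(y, z) \<in> oriented_edges E. z \<in> B} \<le> 3 * card B"
proof -
  have "card (SIGMA y:B. N y) = (\<Sum>y\<in>B. card (N y))" using assms by simp
  also have "\<dots> \<le> (\<Sum>y\<in>B. 3)" by (intro sum_mono card_neighbours_le)
  finally have c: "card (SIGMA y:B. N y) \<le> 3 * card B" by simp
  have "{(y, z) \<in> oriented_edges E. y \<in> B} = (SIGMA y:B. N y)"
    by (auto simp: oriented_edges_def neighbours_iff insert_commute)
  with c show "card {(y, z) \<in> oriented_edges E. y \<in> B} \<le> 3 * card B" by simp
  have "{(y, z) \<in> oriented_edges E. z \<in> B} = prod.swap ` (SIGMA y:B. N y)"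
    by (auto simp: oriented_edges_def neighbours_iff image_iff)
  with c show "card {(y, z) \<in> oriented_edges E. z \<in> B} \<le> 3 * card B"
    by (simp add: card_image)
qed

text \<open>Far vertices share no neighbour, so the new edges \<open>xy\<close> and
  \<open>wz\<close> lie in no triangle, while all triangles on \<open>xw\<close> and on
  \<open>yz\<close> are lost.\<close>

lemma break_far_change_le:
  assumes xw: "(x, w) \<in> ordered_triangles_at E v" and yz: "(y, z) \<in> oriented_edges E"
    and far: "y \<notin> near x" "z \<notin> near w" "y \<notin> near w" "z \<notin> near x"
  shows "break_allowed E v x w y z" and "change (switch E x w y z) \<le> - codeg x w - codeg y z"
proof -
  have v: "v \<in> N x" "v \<in> N w" "x \<in> N w" "w \<in> N x"
    using xw neighbours_commute[of x E w] by (simp_all add: ordered_triangles_at_def triangle_iff)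
  have "y \<noteq> x" "z \<noteq> w" "y \<noteq> w" "z \<noteq> x" "y \<noteq> v" "z \<noteq> v" "y \<notin> N x" "z \<notin> N w"
    using far v by (auto simp: near_def)
  then show allowed: "break_allowed E v x w y z"
    by (auto simp: break_allowed_def neighbours_iff insert_commute)
  have s: "switchable E x w y z" by (rule break_switchable[OF xw yz allowed])
  let ?E' = "switch E x w y z"
  interpret S: cubic_graph n ?E' by unfold_locales (rule switch_cubic[OF s])
  have d: "x \<noteq> w" "x \<noteq> y" "x \<noteq> z" "w \<noteq> y" "w \<noteq> z" "y \<noteq> z"
    using s by (simp_all add: switchable_def)
  have x: "p \<notin> N y" if "p \<in> N x" for p
  proof -
    have "y \<notin> N p" using far(1) that by (auto simp: near_def)
    then show ?thesis by (simp add: neighbours_commute[of p])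
  qed
  have w: "p \<notin> N z" if "p \<in> N w" for p
  proof -
    have "z \<notin> N p" using far(2) that by (auto simp: near_def)
    then show ?thesis by (simp add: neighbours_commute[of p])
  qed
  have "S.N x = insert y (N x - {w})" "S.N y = insert x (N y - {z})"
    "S.N w = insert z (N w - {x})" "S.N z = insert w (N z - {y})"
    unfolding neighbours_switch[OF s] using d by simp_all
  then have "S.N x \<inter> S.N y = {}" "S.N w \<inter> S.N z = {}"
    using d x w neighbours_irrefl by auto
  moreover have "x \<in> S.N y" "w \<in> S.N z" by (auto simp: neighbours_def switch_def)
  ultimately have "card (triangles_on ?E' {x, y}) = 0" "card (triangles_on ?E' {w, z}) = 0"
    by (simp_all add: S.card_triangles_on)
  with card_triangles_switch_le[OF s] show "change ?E' \<le> - codeg x w - codeg y z"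
    by (simp add: codeg_def)
qed

lemma sum_break_change_le:
  assumes xw: "(x, w) \<in> ordered_triangles_at E v"
  shows "(\<Sum>(y, z)\<in>oriented_edges E. change (if break_allowed E v x w y z then break E v x w y z else E)) \<le>
    - 3 * real n * codeg x w - 6 * num_tri + 1248"
proof -
  let ?O = "oriented_edges E"
  \<comment> \<open>The exceptional edges have an end among at most \<open>13 + 13\<close> vertices.
    Counting by first and by second end, there are at most \<open>2 * 3 * 26 = 156\<close> of
    them.\<close>
  define bad where "bad = {(y, z) \<in> ?O. y \<in> near x \<union> near w} \<union> {(y, z) \<in> ?O. z \<in> near x \<union> near w}"
  have "card (near x \<union> near w) \<le> 13 + 13"
    by (intro order.trans[OF card_Un_le] add_mono card_near_le)
  then have "card bad \<le> 3 * 26 + 3 * 26"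
    unfolding bad_def
    by (intro order.trans[OF card_Un_le] add_mono order.trans[OF card_oriented_edges_from_le(1)]
        order.trans[OF card_oriented_edges_from_le(2)]) simp_all
  then have cb: "real (card bad) \<le> 156" by simp
  have bad_sub: "bad \<subseteq> ?O" by (auto simp: bad_def)
  have xw': "x \<in> N w" using xw by (simp add: ordered_triangles_at_def triangle_iff)
  \<comment> \<open>At an exceptional edge the change is at most 4 and both codegrees are at most 2,
    so a correction of 8 suffices. In total this is \<open>8 * 156 = 1248\<close>.\<close>
  have "(\<Sum>(y, z)\<in>?O. change (if break_allowed E v x w y z then break E v x w y z else E)) \<le>
      (\<Sum>p\<in>?O. - codeg x w - codeg (fst p) (snd p) + (if p \<in> bad then 8 else 0))"
  proof (rule sum_mono, clarify)
    fix y z assume yz: "(y, z) \<in> ?O"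
    let ?E' = "if break_allowed E v x w y z then break E v x w y z else E"
    have "y \<in> N z" using yz by (simp add: oriented_edges_def neighbours_iff)
    show "change ?E' \<le> - codeg x w - codeg (fst (y, z)) (snd (y, z)) + (if (y, z) \<in> bad then 8 else 0)"
    proof (cases "(y, z) \<in> bad")
      case True
      have "change ?E' \<le> 4"
        using switch_change_le[of x w y z] break_switchable[OF xw yz]
        by (auto simp: break_eq_switch abs_le_iff)
      then show ?thesis using True codeg_le[OF xw'] codeg_le[OF \<open>y \<in> N z\<close>] by simp
    next
      case False
      then have "y \<notin> near x" "z \<notin> near w" "y \<notin> near w" "z \<notin> near x"
        using yz by (auto simp: bad_def)
      from break_far_change_le[OF xw yz this] False show ?thesis by (simp add: break_eq_switch)
    qed
  qed
  also have "\<dots> = - 3 * real n * codeg x w - (\<Sum>p\<in>?O. codeg (fst p) (snd p)) + 8 * real (card bad)"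
    using bad_sub
    by (simp add: sum.distrib sum_subtractf sum.If_cases card_oriented_edges Int_absorb1 mult.commute)
  also have "(\<Sum>p\<in>?O. codeg (fst p) (snd p)) = 6 * num_tri"
    using sum_codegree_1 by (simp add: codeg_def case_prod_unfold)
  finally show ?thesis using cb by simp
qed

text \<open>Averaging over \<open>3 * n\<close> oriented edges turns 1248 into 416. Averaging over
  \<open>2 * tri_at v\<close> ordered triangles turns the probability \<open>tri_at v / 3\<close>
  into the factor \<open>1 / 6\<close>.\<close>

lemma expectation_break_step_le:
  assumes n: "0 < n"
  shows "tri_at v / 3 * measure_pmf.expectation (break_step E v) change \<le>
    (\<Sum>(x, w)\<in>ordered_triangles_at E v. (416 - 2 * num_tri) / real n - codeg x w) / 6"
proof (cases "card (triangles_at E v) = 0")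
  case True
  then have "ordered_triangles_at E v = {}" using card_ordered_triangles_at[of v] by simp
  with True show ?thesis by simp
next
  case False
  let ?T = "ordered_triangles_at E v" and ?O = "oriented_edges E"
  let ?E' = "\<lambda>x w y z. if break_allowed E v x w y z then break E v x w y z else E"
  have ne: "?T \<noteq> {}" "?O \<noteq> {}"
    using False n card_ordered_triangles_at[of v] card_oriented_edges by auto
  have "measure_pmf.expectation (break_step E v) change =
      (\<Sum>p\<in>?T. measure_pmf.expectation (pmf_of_set ?O \<bind>
        (\<lambda>r. return_pmf (?E' (fst p) (snd p) (fst r) (snd r)))) change / real (card ?T))"
    unfolding break_step_def case_prod_unfold
    by (subst pmf_expectation_bind_pmf_of_set)
      (auto simp: ne set_pmf_of_set divide_inverse mult.commute)
  also have "\<dots> = (\<Sum>p\<in>?T. (\<Sum>r\<in>?O. change (?E' (fst p) (snd p) (fst r) (snd r))) / real (card ?O) / real (card ?T))"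
    by (intro sum.cong[OF refl] arg_cong2[where f = "(/)"] refl, subst pmf_expectation_bind_pmf_of_set)
      (auto simp: ne sum_distrib_left divide_inverse mult.commute)
  also have "\<dots> \<le> (\<Sum>p\<in>?T. (- 3 * real n * codeg (fst p) (snd p) - 6 * num_tri + 1248) / real (card ?O) / real (card ?T))"
    using sum_break_change_le[of _ _ v]
    by (intro sum_mono divide_right_mono) (auto simp: case_prod_unfold)
  also have "\<dots> = (\<Sum>p\<in>?T. (416 - 2 * num_tri) / real n - codeg (fst p) (snd p)) / (2 * tri_at v)"
  proof -
    have "(- 3 * real n * a - 6 * num_tri + 1248) / real (3 * n) = (416 - 2 * num_tri) / real n - a" for a
      using n by (simp add: field_simps)
    then show ?thesis
      by (simp only: sum_divide_distrib card_oriented_edges card_ordered_triangles_at) simp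
  qed
  finally have "tri_at v / 3 * measure_pmf.expectation (break_step E v) change \<le>
      tri_at v / 3 * ((\<Sum>p\<in>?T. (416 - 2 * num_tri) / real n - codeg (fst p) (snd p)) / (2 * tri_at v))"
    by (intro mult_left_mono) simp_all
  then show ?thesis using False by (simp add: case_prod_unfold)
qed

text \<open>The convexity bound \<open>k\<^sup>2 \<ge> 3 k - 2\<close> on the codegrees shows that if there are many
  triangles, then the edge \<open>xw\<close> of a break move often lies in two of them.\<close>

lemma sum_codeg_ge:
  "18 * num_tri - 6 * real n \<le> (\<Sum>v\<in>{1..n}. \<Sum>(x, w)\<in>ordered_triangles_at E v. codeg x w)"
proof -
  \<comment> \<open>Equivalent to \<open>0 \<le> (k - 1) * (k - 2)\<close>, which holds at every
    integer.\<close>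
  have "3 * real k - 2 \<le> real k * real k" for k :: nat
  proof -
    consider "k = 0" | "k = 1" | "2 \<le> k" by linarith
    then show ?thesis
    proof cases
      case 3
      then have "0 \<le> (real k - 1) * (real k - 2)" by simp
      then show ?thesis by (simp add: algebra_simps)
    qed simp_all
  qed
  then have "(\<Sum>(x, w)\<in>oriented_edges E. 3 * codeg x w - 2) \<le>
      (\<Sum>(x, w)\<in>oriented_edges E. codeg x w * real (card (N x \<inter> N w)))"
    by (intro sum_mono) (auto simp: codeg_def)
  also have "\<dots> = (\<Sum>v\<in>{1..n}. \<Sum>(x, w)\<in>ordered_triangles_at E v. codeg x w)"
    by (rule sum_codegree)
  also have "(\<Sum>(x, w)\<in>oriented_edges E. 3 * codeg x w - 2) = 18 * num_tri - 6 * real n"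
    using sum_codegree_1
    by (simp add: case_prod_unfold sum_subtractf codeg_def card_oriented_edges flip: sum_distrib_left)
  finally show ?thesis .
qed

text \<open>With \<tau> for \<open>num_tri / n\<close>, the make branch contributes at most
  \<open>4 * (1 - \<tau>)\<close>, the codegrees of the edges \<open>xw\<close> at most
  \<open>1 - 3 * \<tau>\<close> by \<open>sum_codeg_ge\<close>, and the random edges
  \<open>yz\<close>, exceptional ones included, at most
  \<open>\<tau> * (416 - 2 * num_tri) / n\<close>.\<close>

lemma drift_le:
  assumes n: "0 < n"
  shows "measure_pmf.expectation (chainII_step n E) change \<le>
    5 - 7 * (num_tri / real n) - 2 * (num_tri / real n)\<^sup>2 + 416 * (num_tri / real n) / real n"
proof -
  let ?A = "(416 - 2 * num_tri) / real n"
  let ?S = "\<lambda>v. \<Sum>(x, w)\<in>ordered_triangles_at E v. codeg x w"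
  have v: "measure_pmf.expectation (step_at v) change \<le>
      4 * (1 - tri_at v / 3) + (2 * tri_at v * ?A - ?S v) / 6"
    if v: "v \<in> {1..n}" for v
  proof -
    have "(1 - tri_at v / 3) * measure_pmf.expectation (make_step E v) change \<le> (1 - tri_at v / 3) * 4"
    proof (cases "card (triangles_at E v) < 3")
      case True
      have "change E' \<le> 4" if E': "E' \<in> set_pmf (make_step E v)" for E'
      proof -
        obtain q where q: "q \<in> path_pairs E v" "E' = make_pair E q"
          using E' unfolding set_pmf_make_step[OF v True] by blast
        from q(1) obtain x y w z where "switchable E x y w z" "make_pair E q = switch E x y w z"
          by (rule path_pairsE)
        with q(2) switch_change_le[of x y w z] show ?thesis by simp
      qed
      then have "measure_pmf.expectation (make_step E v) change \<le> 4"
        by (intro expectation_le finite_set_pmf_make_step v True)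
      then show ?thesis using True by (intro mult_left_mono) auto
    next
      case False
      then have "tri_at v = 3" using card_triangles_at_le[of v] by simp
      then show ?thesis by simp
    qed
    moreover have S: "(\<Sum>(x, w)\<in>ordered_triangles_at E v. ?A - codeg x w) = 2 * tri_at v * ?A - ?S v"
      by (simp add: case_prod_unfold sum_subtractf card_ordered_triangles_at)
    ultimately have "measure_pmf.expectation (step_at v) change \<le>
        (2 * tri_at v * ?A - ?S v) / 6 + (1 - tri_at v / 3) * 4"
      using expectation_break_step_le[OF n, of v] unfolding expectation_step_at[OF v] S
      by (intro add_mono)
    then show ?thesis by (simp only: add.commute mult.commute)
  qed
  have "(\<Sum>v\<in>{1..n}. measure_pmf.expectation (step_at v) change) \<le>
      (\<Sum>v\<in>{1..n}. 4 * (1 - tri_at v / 3) + (2 * tri_at v * ?A - ?S v) / 6)"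
    by (rule sum_mono) (rule v)
  also have "\<dots> = (\<Sum>v\<in>{1..n}. 4 + tri_at v * (?A / 3 - 4 / 3) - ?S v / 6)"
  proof -
    have "4 * (1 - t / 3) + (2 * t * a - s) / 6 = 4 + t * (a / 3 - 4 / 3) - s / 6" for t a s :: real
      by (simp add: field_simps)
    then show ?thesis by (simp only:)
  qed
  also have "\<dots> = 4 * real n + (\<Sum>v\<in>{1..n}. tri_at v) * (?A / 3 - 4 / 3) - (\<Sum>v\<in>{1..n}. ?S v) / 6"
    unfolding sum_subtractf sum.distrib sum_distrib_right sum_divide_distrib by simp
  also have "\<dots> \<le> 4 * real n + 3 * num_tri * (?A / 3 - 4 / 3) - (18 * num_tri - 6 * real n) / 6"
    unfolding sum_tri_at using sum_codeg_ge by (intro diff_mono divide_right_mono) auto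
  also have "\<dots> = 5 * real n - 7 * num_tri + num_tri * ?A"
  proof -
    have "4 * m + 3 * t * (a / 3 - 4 / 3) - (18 * t - 6 * m) / 6 = 5 * m - 7 * t + t * a" for m t a :: real
      by (simp add: field_simps)
    then show ?thesis .
  qed
  finally have "(\<Sum>v\<in>{1..n}. measure_pmf.expectation (step_at v) change) / real n \<le>
      (5 * real n - 7 * num_tri + num_tri * ?A) / real n"
    using n by (intro divide_right_mono) auto
  also have "\<dots> = 5 - 7 * (num_tri / real n) - 2 * (num_tri / real n)\<^sup>2 + 416 * (num_tri / real n) / real n"
    using n by (simp add: field_simps power2_eq_square)
  finally show ?thesis using n by (simp add: expectation_chainII_step)
qed

lemma num_tri_le: "num_tri \<le> real n"
proof -
  have "(\<Sum>v\<in>{1..n}. tri_at v) \<le> (\<Sum>v\<in>{1..n}. 3)"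
    using card_triangles_at_le by (intro sum_mono) simp
  then show ?thesis by (simp only: sum_tri_at) simp
qed

end

section \<open>Both bounds as drift families, and the theorem\<close>

lemma finite_cubic_graphs: "finite (cubic_graphs n)"
  by (rule finite_subset[of _ "Pow (Pow {1..n})"]) (auto simp: cubic_graphs_def)

text \<open>The sign \<open>s\<close> lets one statement serve both one-sided bounds.\<close>

lemma drift_chain_chainII:
  fixes Y :: "graph \<Rightarrow> real" and s a :: real
  assumes n: "0 < n" and c: "0 < c" "c \<le> 1" and s: "\<bar>s\<bar> = 1"
    and drift: "\<And>E. E \<in> cubic_graphs n \<Longrightarrow> 0 \<le> s * real (card (triangles E)) + a \<Longrightarrow>
      s * measure_pmf.expectation (chainII_step n E)
        (\<lambda>E'. real (card (triangles E')) - real (card (triangles E))) \<le> - c"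
  shows "drift_chain (chainII_step n) (cubic_graphs n) (\<lambda>E. s * real (card (triangles E)) + a) c"
proof
  show "finite (cubic_graphs n)" by (rule finite_cubic_graphs)
next
  fix E assume E: "E \<in> cubic_graphs n"
  interpret cubic_graph n E by unfold_locales (rule E)
  show "set_pmf (chainII_step n E) \<subseteq> cubic_graphs n"
    using set_pmf_chainII_step[OF n] E switch_cubic by blast
  show "\<bar>(s * real (card (triangles E')) + a) - (s * num_tri + a)\<bar> \<le> 4"
    if "E' \<in> set_pmf (chainII_step n E)" for E'
  proof -
    have "\<bar>(s * real (card (triangles E')) + a) - (s * num_tri + a)\<bar> = \<bar>s\<bar> * \<bar>change E'\<bar>"
      by (simp add: algebra_simps flip: abs_mult)
    also have "\<dots> \<le> 4" using step_jump[OF set_pmf_chainII_step[OF n that]] s by simp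
    finally show ?thesis .
  qed
  have "(\<lambda>E'. (s * real (card (triangles E')) + a) - (s * num_tri + a)) = (\<lambda>E'. s * change E')"
    by (simp add: fun_eq_iff algebra_simps)
  then show "measure_pmf.expectation (chainII_step n E)
      (\<lambda>E'. (s * real (card (triangles E')) + a) - (s * num_tri + a)) \<le> - c"
    if "0 \<le> s * num_tri + a"
    using drift[OF E that] by (simp only: integral_mult_right_zero)
qed (rule c)+

text \<open>The drift at the threshold is \<open>1 - 10 * 0.095 = 1 / 20\<close>, and the margin
  between the thresholds is \<open>0.095 - 0.09 = 1 / 200\<close>.\<close>

interpretation lower: drift_family chainII_step cubic_graphs
  "\<lambda>n E. - 1 * real (card (triangles E)) + 0.095 * real n"
  "\<lambda>n E. \<not> 0.09 * real n \<le> real (card (triangles E))" "1 / 20" "1 / 200"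
proof
  show "\<forall>\<^sub>F n in sequentially. drift_chain (chainII_step n) (cubic_graphs n)
      (\<lambda>E. - 1 * real (card (triangles E)) + 0.095 * real n) (1 / 20)"
    using eventually_gt_at_top[of 0]
  proof eventually_elim
    case (elim n)
    show ?case
    proof (rule drift_chain_chainII[OF elim])
      fix E assume E: "E \<in> cubic_graphs n" and Y: "0 \<le> - 1 * real (card (triangles E)) + 0.095 * real n"
      interpret cubic_graph n E by unfold_locales (rule E)
      have "num_tri / real n \<le> 0.095" using Y elim by (simp add: field_simps)
      with drift_ge[OF elim] show "- 1 * measure_pmf.expectation (chainII_step n E) change \<le> - (1 / 20)"
        by simp
    qed simp_all
  qed
qed simp_all

text \<open>The margin \<open>0.63 - 0.62\<close> exceeds \<open>1 / 200\<close>. Taking the same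
  \<open>c\<close> as in \<open>lower\<close> gives both families the same \<open>C\<close>.\<close>

interpretation upper: drift_family chainII_step cubic_graphs
  "\<lambda>n E. 1 * real (card (triangles E)) + - 0.62 * real n"
  "\<lambda>n E. \<not> real (card (triangles E)) \<le> 0.63 * real n" "1 / 20" "1 / 200"
proof
  show "\<forall>\<^sub>F n in sequentially. drift_chain (chainII_step n) (cubic_graphs n)
      (\<lambda>E. 1 * real (card (triangles E)) + - 0.62 * real n) (1 / 20)"
    \<comment> \<open>From 8320 on the error term is at most \<open>416 / 8320 = 0.05\<close>. At
      \<tau> = 0.62 the main terms are \<open>5 - 4.34 - 0.7688 = - 0.1088\<close>, which leaves
      less than \<open>- 1 / 20\<close>.\<close>
    using eventually_ge_at_top[of 8320]
  proof eventually_elim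
    case (elim n)
    then have n: "0 < n" by simp
    show ?case
    proof (rule drift_chain_chainII[OF n])
      fix E assume E: "E \<in> cubic_graphs n" and Y: "0 \<le> 1 * real (card (triangles E)) + - 0.62 * real n"
      interpret cubic_graph n E by unfold_locales (rule E)
      define \<tau> where "\<tau> = num_tri / real n"
      have \<tau>: "0.62 \<le> \<tau>" "\<tau> \<le> 1" using Y n num_tri_le by (simp_all add: \<tau>_def field_simps)
      have "0.62\<^sup>2 \<le> \<tau>\<^sup>2" using \<tau> by (intro power_mono) simp_all
      moreover have "416 * \<tau> / real n \<le> 416 * 1 / 8320"
        using \<tau> elim by (intro frac_le mult_left_mono) simp_all
      moreover have "measure_pmf.expectation (chainII_step n E) change \<le> 5 - 7 * \<tau> - 2 * \<tau>\<^sup>2 + 416 * \<tau> / real n"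
        using drift_le[OF n] by (simp add: \<tau>_def)
      ultimately show "1 * measure_pmf.expectation (chainII_step n E) change \<le> - (1 / 20)"
        using \<tau> by (simp add: power2_eq_square)
    qed simp_all
  qed
  show "1 * real (card (triangles E)) + - 0.62 * real n \<le> real n" if "E \<in> cubic_graphs n" for n E
  proof -
    interpret cubic_graph n E by unfold_locales (rule that)
    show ?thesis using num_tri_le by simp
  qed
qed simp_all

lemma in_the_long_runI:
  assumes "drift_family chainII_step cubic_graphs Y (\<lambda>n E. \<not> \<E> n E) c \<delta>"
  shows "in_the_long_run \<E>"
proof -
  interpret drift_family chainII_step cubic_graphs Y "\<lambda>n E. \<not> \<E> n E" c \<delta> by (rule assms)
  show ?thesis
    unfolding in_the_long_run_def
  proof (intro exI[of _ C] conjI allI impI)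
    show "0 < C" using c0 by (simp add: add_pos_pos)
    fix \<epsilon> :: real assume "0 < \<epsilon>"
    from eventually_long_run[OF this] show "\<forall>\<^sub>F n in sequentially. even n \<longrightarrow>
      (\<forall>G\<in>cubic_graphs n.
        \<P>(\<omega> in chainII n G. \<forall>t::nat. C * real n \<le> real t \<longrightarrow>
            real (card {s \<in> {1..t}. C * real n \<le> real s \<and> \<not> \<E> n (\<omega> s)}) \<le> \<epsilon> * real t) \<ge> 1 - \<epsilon> \<and>
        (AE \<omega> in chainII n G. \<forall>\<^sub>F t in sequentially.
            real (card {s \<in> {1..t}. \<not> \<E> n (\<omega> s)}) \<le> \<epsilon> * real t))"
      unfolding chainII_def by eventually_elim simp
  qed
qed

theorem theorem2:
  fixes \<alpha> \<beta> :: real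
  assumes "\<alpha> = 0.09" and "\<beta> = 0.63"
  shows "\<exists>C::real. C > 0 \<and>
    (\<forall>\<epsilon>>0. \<forall>\<^sub>F n in sequentially. even n \<longrightarrow>
       (\<forall>G\<in>cubic_graphs n.
          \<P>(\<omega> in chainII n G.
             \<alpha> * real n \<le> real (card (triangles (\<omega> (nat \<lfloor>C * real n\<rfloor>)))) \<and>
             real (card (triangles (\<omega> (nat \<lfloor>C * real n\<rfloor>)))) \<le> \<beta> * real n) \<ge> 1 - \<epsilon>)) \<and>
    in_the_long_run (\<lambda>n E. \<alpha> * real n \<le> real (card (triangles E))) \<and>
    in_the_long_run (\<lambda>n E. real (card (triangles E)) \<le> \<beta> * real n)"
  unfolding assms
\<comment> \<open>The witness is the common \<open>C\<close> of both families, equal to 41.\<close>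
proof (intro exI[of _ "2 / (1 / 20) + 1"] conjI allI impI)
  show "in_the_long_run (\<lambda>n E. 0.09 * real n \<le> real (card (triangles E)))"
    by (rule in_the_long_runI) (rule lower.drift_family_axioms)
  show "in_the_long_run (\<lambda>n E. real (card (triangles E)) \<le> 0.63 * real n)"
    by (rule in_the_long_runI) (rule upper.drift_family_axioms)
  fix \<epsilon> :: real assume "0 < \<epsilon>"
  \<comment> \<open>Too few and too many triangles each get half of the allowed probability.\<close>
  then have "0 < \<epsilon> / 2" by simp
  define t where "t n = nat \<lfloor>(2 / (1 / 20) + 1 :: real) * real n\<rfloor>" for n
  have "\<forall>\<^sub>F n in sequentially. even n \<longrightarrow> (\<forall>G\<in>cubic_graphs n.
      1 - \<epsilon> \<le> measure (chainII n G) {\<omega> \<in> space (chainII n G).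
        0.09 * real n \<le> real (card (triangles (\<omega> (t n)))) \<and>
        real (card (triangles (\<omega> (t n)))) \<le> 0.63 * real n})"
    using lower.eventually_prob_bad_le[OF \<open>0 < \<epsilon> / 2\<close>] upper.eventually_prob_bad_le[OF \<open>0 < \<epsilon> / 2\<close>]
  proof eventually_elim
    case (elim n)
    show ?case
    proof (intro impI ballI)
      fix G assume G: "G \<in> cubic_graphs n"
      let ?M = "chainII n G"
      interpret prob_space ?M unfolding chainII_def by (rule prob_space_markov_chain)
      let ?L = "{\<omega>. \<not> 0.09 * real n \<le> real (card (triangles (\<omega> (t n))))}"
      let ?U = "{\<omega>. \<not> real (card (triangles (\<omega> (t n)))) \<le> 0.63 * real n}"
      have meas: "{\<omega>. P (\<omega> i)} \<in> sets ?M" for P i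
      proof -
        note pred_component_count_space[where P = P, measurable]
        have "{\<omega> \<in> space ?M. P (\<omega> i)} \<in> sets ?M" unfolding chainII_def by measurable
        then show ?thesis by (simp add: chainII_def)
      qed
      have LU: "?L \<in> sets ?M" "?U \<in> sets ?M" by (rule meas)+
      have "prob (?L \<union> ?U) \<le> prob ?L + prob ?U" using LU by (rule measure_Un_le)
      also have "\<dots> \<le> \<epsilon> / 2 + \<epsilon> / 2"
        using elim G unfolding t_def chainII_def by (intro add_mono) blast+
      finally have "1 - \<epsilon> \<le> prob (space ?M - (?L \<union> ?U))"
        using prob_compl[OF sets.Un[OF LU]] by simp
      also have "space ?M - (?L \<union> ?U) = {\<omega> \<in> space ?M.
          0.09 * real n \<le> real (card (triangles (\<omega> (t n)))) \<and>
          real (card (triangles (\<omega> (t n)))) \<le> 0.63 * real n}"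
        by auto
      finally show "1 - \<epsilon> \<le> prob \<dots>" .
    qed
  qed
  then show "\<forall>\<^sub>F n in sequentially. even n \<longrightarrow> (\<forall>G\<in>cubic_graphs n.
      \<P>(\<omega> in chainII n G.
        0.09 * real n \<le> real (card (triangles (\<omega> (nat \<lfloor>(2 / (1 / 20) + 1) * real n\<rfloor>)))) \<and>
        real (card (triangles (\<omega> (nat \<lfloor>(2 / (1 / 20) + 1) * real n\<rfloor>)))) \<le> 0.63 * real n) \<ge> 1 - \<epsilon>)"
    unfolding t_def .
qed simp

end
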